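(* Let $d\ge2$ and let $\mathcal{L}=-\mathrm{div}(A\nabla)$, where $A=(a_{ij}(X))$ is a $C^\infty$, real, symmetric $(d+1)\times(d+1)$ matrix on $\mathbb{R}^{d+1}$ with $\mu|\xi|^2\le a_{ij}(X)\xi_i\xi_j\le\mu^{-1}|\xi|^2$ for all $X,\xi\in\mathbb{R}^{d+1}$ ($\mu>0$) and $A(x,t+1)=A(x,t)$ for all $(x,t)\in\mathbb{R}^d\times\mathbb{R}$. Let $x_0\in\mathbb{R}^d$, $R>10$, and let $u\in C^1(\overline\Omega)$ be a solution to $\mathcal{L}(u)=0$ in $\Omega=T(x_0,3R)$ with $\frac{\partial u}{\partial\nu}=g$ on $B(x_0,3R)\times\{0\}$. Then $$\int_0^1\int_{B(x_0,R)}|\nabla u|^2\,dx\,dt\le C\int_{B(x_0,2R)}|g|^2\,dx+\frac CR\iint_{T(x_0,3R)\setminus T(x_0,R)}|\nabla u|^2\,dx\,dt,$$ where $C$ depends only on $d$ and $\mu$.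
   Context: Repeated indices are summed from $1$ to $d+1$, with $x_{d+1}=t$. $B(x,r)$ is the ball in $\mathbb{R}^d$, $T(x,r)=B(x,r)\times(0,r)$, and $\nabla$ is the gradient in $\mathbb{R}^{d+1}$. $\frac{\partial u}{\partial\nu}=a_{ij}\frac{\partial u}{\partial x_j}n_i$ is the conormal derivative, $n$ the outward unit normal; on $B(x_0,3R)\times\{0\}$ it equals $-a_{(d+1)j}\frac{\partial u}{\partial x_j}$. *)

theory Defs
  imports "HOL-Analysis.Analysis"
begin

text \<open>
  The space of pairs \<open>X = (x, t)\<close> is the Euclidean space \<open>(real ^ 'd) \<times> real\<close>. The role of the
  index set \<open>{1, \<dots>, d + 1}\<close> is played by its standard orthonormal basis \<open>Basis\<close>: the \<open>i\<close>-th
  coordinate of \<open>X\<close> is \<open>X \<bullet> i\<close>, and the last basis vector is \<open>(0, 1)\<close>. A matrix of coefficients is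
  given by its entries \<open>a i j X\<close> with \<open>i, j \<in> Basis\<close>; other values of \<open>i, j\<close> are irrelevant.
\<close>

primrec Ck :: "nat \<Rightarrow> ('a::euclidean_space \<Rightarrow> real) \<Rightarrow> bool" where
  "Ck 0 f \<longleftrightarrow> continuous_on UNIV f"
| "Ck (Suc k) f \<longleftrightarrow>
     (\<exists>Df. (\<forall>X. GDERIV f X :> Df X) \<and> (\<forall>i\<in>Basis. Ck k (\<lambda>X. Df X \<bullet> i)))"

definition smooth :: "('a::euclidean_space \<Rightarrow> real) \<Rightarrow> bool" where
  "smooth f \<longleftrightarrow> (\<forall>k. Ck k f)"

definition symmetric_coeffs :: "('a::euclidean_space \<Rightarrow> 'a \<Rightarrow> 'a \<Rightarrow> real) \<Rightarrow> bool" where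
  "symmetric_coeffs a \<longleftrightarrow> (\<forall>X. \<forall>i\<in>Basis. \<forall>j\<in>Basis. a i j X = a j i X)"

definition elliptic_coeffs :: "real \<Rightarrow> ('a::euclidean_space \<Rightarrow> 'a \<Rightarrow> 'a \<Rightarrow> real) \<Rightarrow> bool" where
  "elliptic_coeffs \<mu> a \<longleftrightarrow>
     (\<forall>X \<xi>. \<mu> * (norm \<xi>)\<^sup>2 \<le> (\<Sum>i\<in>Basis. \<Sum>j\<in>Basis. a i j X * (\<xi> \<bullet> i) * (\<xi> \<bullet> j)) \<and>
             (\<Sum>i\<in>Basis. \<Sum>j\<in>Basis. a i j X * (\<xi> \<bullet> i) * (\<xi> \<bullet> j)) \<le> inverse \<mu> * (norm \<xi>)\<^sup>2)"

definition T_cyl :: "real ^ 'd \<Rightarrow> real \<Rightarrow> ((real ^ 'd) \<times> real) set" where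
  "T_cyl x r = ball x r \<times> {0<..<r}"

text \<open>
  \<open>u\<close> belongs to \<open>C\<^sup>1(closure \<Omega>)\<close>, that is, \<open>u\<close> is differentiable in the open set \<open>\<Omega>\<close> and its
  gradient extends continuously to the closure; \<open>Du\<close> is the extended gradient, which is uniquely
  determined on \<open>closure \<Omega>\<close> by \<open>u\<close> and \<open>\<Omega>\<close>.
\<close>
definition C1_closure_with_grad ::
    "'a::euclidean_space set \<Rightarrow> ('a \<Rightarrow> real) \<Rightarrow> ('a \<Rightarrow> 'a) \<Rightarrow> bool" where
  "C1_closure_with_grad \<Omega> u Du \<longleftrightarrow>
     continuous_on (closure \<Omega>) u \<and> continuous_on (closure \<Omega>) Du \<and>
     (\<forall>X\<in>\<Omega>. GDERIV u X :> Du X)"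

definition C1_test_with_grad ::
    "'a::euclidean_space set \<Rightarrow> ('a \<Rightarrow> real) \<Rightarrow> ('a \<Rightarrow> 'a) \<Rightarrow> bool" where
  "C1_test_with_grad \<Omega> \<phi> D\<phi> \<longleftrightarrow>
     (\<forall>X. GDERIV \<phi> X :> D\<phi> X) \<and> continuous_on UNIV D\<phi> \<and>
     compact (closure {X. \<phi> X \<noteq> 0}) \<and> closure {X. \<phi> X \<noteq> 0} \<subseteq> \<Omega>"

text \<open>
  The equation \<open>- div (A \<nabla>u) = 0\<close> in \<open>\<Omega>\<close> for a function \<open>u\<close> with gradient \<open>Du\<close> that is only known
  to be \<open>C\<^sup>1\<close> is understood in the usual weak sense, with \<open>C\<^sup>1\<close> test functions of compact support.
\<close>
definition weak_solution ::
    "('a::euclidean_space \<Rightarrow> 'a \<Rightarrow> 'a \<Rightarrow> real) \<Rightarrow> 'a set \<Rightarrow> ('a \<Rightarrow> 'a) \<Rightarrow> bool" where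
  "weak_solution a \<Omega> Du \<longleftrightarrow>
     (\<forall>\<phi> D\<phi>. C1_test_with_grad \<Omega> \<phi> D\<phi> \<longrightarrow>
        (LINT X:\<Omega>|lborel. (\<Sum>i\<in>Basis. \<Sum>j\<in>Basis. a i j X * (Du X \<bullet> j) * (D\<phi> X \<bullet> i))) = 0)"

definition conormal_deriv ::
    "('a::euclidean_space \<Rightarrow> 'a \<Rightarrow> 'a \<Rightarrow> real) \<Rightarrow> ('a \<Rightarrow> 'a) \<Rightarrow> 'a \<Rightarrow> 'a \<Rightarrow> real" where
  "conormal_deriv a Du n X = (\<Sum>i\<in>Basis. \<Sum>j\<in>Basis. a i j X * (Du X \<bullet> j) * (n \<bullet> i))"

end

theory Submission
  imports Defs
begin

text \<open>
  The estimate is a discrete Rellich inequality. If the coefficients did not depend on \<open>t\<close>, one would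
  test the equation with \<open>\<partial>\<^sub>t u\<close>; for coefficients of period one in \<open>t\<close> its place is taken by the
  vertical difference \<open>q(X) = u(X + e) - u(X)\<close> with \<open>e = (0, 1)\<close>. Write \<open>B\<close> for the bilinear form of
  the coefficients at \<open>X\<close>. Periodicity and symmetry give the polarisation identity
  \<open>2 B(\<nabla>u(X), \<nabla>q(X)) = E(X + e) - E(X) - B(\<nabla>q(X), \<nabla>q(X))\<close>, where \<open>E = B(\<nabla>u, \<nabla>u)\<close>. After
  multiplication by a cutoff \<open>\<alpha>(x) \<beta>(t)\<close> that equals one on \<open>T(x\<^sub>0, R)\<close> and varies on the scale \<open>R\<close>,
  the difference \<open>E(X + e) - E(X)\<close> telescopes in the integral over \<open>t > 0\<close>: what remains is minus the
  energy of the slab \<open>0 < t \<le> 1\<close>, which is the quantity to be estimated, and a term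
  \<open>\<alpha>(x) (\<beta>(t - 1) - \<beta>(t)) E\<close>, which is of order \<open>E/R\<close> and lives at the heights \<open>R < t < 2R + 1\<close>
  (\<open>telescoped_energy_le\<close>). The term with \<open>\<nabla>q\<close> has a favourable sign.

  Green's formula (\<open>green_identity\<close>) turns the integral of \<open>B(\<nabla>u, \<nabla>(\<alpha> \<beta> q))\<close> into the boundary
  integral of \<open>\<alpha> g q\<close>. Since \<open>q\<close> is the integral of \<open>\<partial>\<^sub>t u\<close> over a vertical segment of length one,
  \<open>q\<^sup>2\<close> is at most the integral of \<open>|\<nabla>u|\<^sup>2\<close> over that segment (\<open>q_power2_le\<close>). Used at \<open>t = 0\<close>, this
  bounds the boundary integral by a small multiple of the slab energy, weighted by the same \<open>\<alpha>\<close> and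
  hence absorbed, plus a multiple of the integral of \<open>g\<^sup>2\<close>. Used where \<open>\<nabla>(\<alpha> \<beta>)\<close>, which is of order
  \<open>1/R\<close>, does not vanish, it bounds the cutoff error by \<open>C/R\<close> times the energy outside \<open>T(x\<^sub>0, R)\<close>:
  vertical shifts by at most one lead from there neither into \<open>T(x\<^sub>0, R)\<close> nor out of \<open>T(x\<^sub>0, 3R)\<close>.

  The equation holds weakly in the open cylinder, so Green's formula is obtained from test functions
  that are cut off near \<open>t = 0\<close> at the scale \<open>1/n\<close>. The derivatives of these cutoffs are an approximate
  identity at \<open>t = 0\<close>, and continuity of \<open>\<nabla>u\<close> up to the bottom yields the boundary term.
\<close>

section \<open>A smooth step\<close>

text \<open>
  The primitive of the tent function of height two over \<open>[0, 1]\<close>. Written through truncated squares,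
  which are continuously differentiable on the whole line, it needs no gluing of derivatives.
\<close>
definition smoothstep :: "real \<Rightarrow> real" where
  "smoothstep s = 2 * (max 0 s)\<^sup>2 - 4 * (max 0 (s - 1/2))\<^sup>2 + 2 * (max 0 (s - 1))\<^sup>2"

definition smoothstep_deriv :: "real \<Rightarrow> real" where
  "smoothstep_deriv s = 4 * max 0 s - 8 * max 0 (s - 1/2) + 4 * max 0 (s - 1)"

lemma has_real_derivative_max_0_power2:
  "((\<lambda>s::real. (max 0 s)\<^sup>2) has_real_derivative 2 * max 0 s) (at s)"
proof (cases s "0::real" rule: linorder_cases)
  case less
  have "((\<lambda>s::real. 0) has_real_derivative 0) (at s)" by simp
  then have "((\<lambda>s::real. (max 0 s)\<^sup>2) has_real_derivative 0) (at s)"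
    by (rule has_field_derivative_transform_within_open[where S = "{..<0}"]) (use less in auto)
  then show ?thesis using less by simp
next
  case equal
  have "((\<lambda>h::real. (max 0 h)\<^sup>2 / h) \<longlongrightarrow> 0) (at 0)"
  proof (rule Lim_null_comparison)
    show "\<forall>\<^sub>F h in at 0. norm ((max 0 h)\<^sup>2 / h) \<le> \<bar>h\<bar>"
      by (intro always_eventually allI) (auto simp: max_def power2_eq_square)
    show "((\<lambda>h::real. \<bar>h\<bar>) \<longlongrightarrow> 0) (at 0)"
      by (rule tendsto_rabs_zero) simp
  qed
  then show ?thesis using equal by (simp add: DERIV_def)
next
  case greater
  have "((\<lambda>s::real. s\<^sup>2) has_real_derivative 2 * s) (at s)"
    by (auto intro!: derivative_eq_intros)
  then have "((\<lambda>s::real. (max 0 s)\<^sup>2) has_real_derivative 2 * s) (at s)"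
    by (rule has_field_derivative_transform_within_open[where S = "{0<..}"]) (use greater in auto)
  then show ?thesis using greater by simp
qed

lemma has_real_derivative_smoothstep:
  "(smoothstep has_real_derivative smoothstep_deriv s) (at s)"
proof -
  have shifted: "((\<lambda>s::real. (max 0 (s - c))\<^sup>2) has_real_derivative 2 * max 0 (s - c)) (at s)" for c
    by (rule DERIV_chain2[where f = "\<lambda>s. (max 0 s)\<^sup>2" and Db = 1,
          OF has_real_derivative_max_0_power2, simplified])
       (auto intro!: derivative_eq_intros)
  show ?thesis
    unfolding smoothstep_def smoothstep_deriv_def
    using DERIV_add[OF DERIV_diff[OF DERIV_cmult[OF shifted[of 0], of 2]
          DERIV_cmult[OF shifted[of "1/2"], of 4]] DERIV_cmult[OF shifted[of 1], of 2]]
    by simp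
qed

lemma continuous_smoothstep_deriv: "continuous_on A smoothstep_deriv"
  unfolding smoothstep_deriv_def by (intro continuous_intros)

lemma continuous_smoothstep: "continuous_on A smoothstep"
  unfolding smoothstep_def by (intro continuous_intros)

lemma smoothstep_eq_0: "s \<le> 0 \<Longrightarrow> smoothstep s = 0"
  by (simp add: smoothstep_def)

lemma smoothstep_eq_1: "s \<ge> 1 \<Longrightarrow> smoothstep s = 1"
  by (simp add: smoothstep_def power2_eq_square algebra_simps)

lemma smoothstep_deriv_eq_0: "s \<le> 0 \<or> s \<ge> 1 \<Longrightarrow> smoothstep_deriv s = 0"
  by (auto simp: smoothstep_deriv_def)

lemma smoothstep_deriv_bounds: "0 \<le> smoothstep_deriv s" "smoothstep_deriv s \<le> 2"
  by (auto simp: smoothstep_deriv_def max_def)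

lemma smoothstep_mono: "s \<le> s' \<Longrightarrow> smoothstep s \<le> smoothstep s'"
  by (rule DERIV_nonneg_imp_nondecreasing)
     (use has_real_derivative_smoothstep smoothstep_deriv_bounds in blast)+

lemma smoothstep_bounds: "0 \<le> smoothstep s" "smoothstep s \<le> 1"
  using smoothstep_mono[of "min 0 s" s] smoothstep_mono[of s "max 1 s"]
  by (auto simp: smoothstep_eq_0 smoothstep_eq_1)

lemma smoothstep_lipschitz:
  assumes "s \<le> s'"
  shows "smoothstep s' - smoothstep s \<le> 2 * (s' - s)"
proof -
  have "2 * s - smoothstep s \<le> 2 * s' - smoothstep s'"
  proof (rule DERIV_nonneg_imp_nondecreasing[OF assms])
    fix x
    have "((\<lambda>s. 2 * s - smoothstep s) has_real_derivative 2 - smoothstep_deriv x) (at x)"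
      by (auto intro!: derivative_eq_intros has_real_derivative_smoothstep)
    then show "\<exists>y. ((\<lambda>s. 2 * s - smoothstep s) has_real_derivative y) (at x) \<and> 0 \<le> y"
      using smoothstep_deriv_bounds(2)[of x] by (intro exI[of _ "2 - smoothstep_deriv x"]) auto
  qed
  then show ?thesis by simp
qed

lemma integral_smoothstep_deriv: "(LINT s|lborel. smoothstep_deriv s) = 1"
proof -
  have "has_bochner_integral lborel (\<lambda>s. smoothstep_deriv s * indicator {0..1} s)
          (smoothstep 1 - smoothstep 0)"
    by (rule has_bochner_integral_FTC_Icc_real)
       (use has_real_derivative_smoothstep continuous_smoothstep_deriv[of UNIV] in
        \<open>auto simp: continuous_on_eq_continuous_at\<close>)
  moreover have "smoothstep_deriv s * indicator {0..1} s = smoothstep_deriv s" for s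
    by (cases "s \<le> 0 \<or> s \<ge> 1") (auto simp: smoothstep_deriv_eq_0 indicator_def)
  ultimately show ?thesis
    by (simp add: has_bochner_integral_iff smoothstep_eq_0 smoothstep_eq_1)
qed

section \<open>The quadratic form of the coefficients\<close>

definition coeff_form ::
    "('a::euclidean_space \<Rightarrow> 'a \<Rightarrow> 'a \<Rightarrow> real) \<Rightarrow> 'a \<Rightarrow> 'a \<Rightarrow> 'a \<Rightarrow> real" where
  "coeff_form a X \<xi> \<zeta> = (\<Sum>i\<in>Basis. \<Sum>j\<in>Basis. a i j X * (\<xi> \<bullet> j) * (\<zeta> \<bullet> i))"

lemma coeff_form_bilinear:
  "coeff_form a X (\<xi> + \<eta>) \<zeta> = coeff_form a X \<xi> \<zeta> + coeff_form a X \<eta> \<zeta>"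
  "coeff_form a X \<xi> (\<zeta> + \<eta>) = coeff_form a X \<xi> \<zeta> + coeff_form a X \<xi> \<eta>"
  "coeff_form a X (\<xi> - \<eta>) \<zeta> = coeff_form a X \<xi> \<zeta> - coeff_form a X \<eta> \<zeta>"
  "coeff_form a X \<xi> (\<zeta> - \<eta>) = coeff_form a X \<xi> \<zeta> - coeff_form a X \<xi> \<eta>"
  "coeff_form a X (c *\<^sub>R \<xi>) \<zeta> = c * coeff_form a X \<xi> \<zeta>"
  "coeff_form a X \<xi> (c *\<^sub>R \<zeta>) = c * coeff_form a X \<xi> \<zeta>"
  "coeff_form a X 0 \<zeta> = 0"
  "coeff_form a X \<xi> 0 = 0"
  by (simp_all add: coeff_form_def inner_add_left inner_diff_left sum.distrib sum_subtractf
      sum_distrib_left algebra_simps)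

lemma coeff_form_commute:
  assumes "symmetric_coeffs a"
  shows "coeff_form a X \<xi> \<zeta> = coeff_form a X \<zeta> \<xi>"
  unfolding coeff_form_def
  by (subst sum.swap, intro sum.cong refl)
     (use assms in \<open>simp add: symmetric_coeffs_def mult_ac\<close>)

lemma coeff_form_elliptic:
  assumes "elliptic_coeffs \<mu> a"
  shows "\<mu> * (norm \<xi>)\<^sup>2 \<le> coeff_form a X \<xi> \<xi>" "coeff_form a X \<xi> \<xi> \<le> (norm \<xi>)\<^sup>2 / \<mu>"
proof -
  have "coeff_form a X \<xi> \<xi> = (\<Sum>i\<in>Basis. \<Sum>j\<in>Basis. a i j X * (\<xi> \<bullet> i) * (\<xi> \<bullet> j))"
    unfolding coeff_form_def by (simp add: mult_ac)
  then show "\<mu> * (norm \<xi>)\<^sup>2 \<le> coeff_form a X \<xi> \<xi>" "coeff_form a X \<xi> \<xi> \<le> (norm \<xi>)\<^sup>2 / \<mu>"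
    using assms unfolding elliptic_coeffs_def by (simp_all add: divide_inverse mult.commute)
qed

text \<open>
  Expand the nonnegative values of the form at \<open>\<xi> + \<zeta>\<close> and \<open>\<xi> - \<zeta>\<close>. The additive version of the
  Cauchy-Schwarz inequality suffices, as \<open>\<zeta>\<close> can be rescaled before it is applied.
\<close>
lemma abs_coeff_form_le:
  assumes "symmetric_coeffs a" "elliptic_coeffs \<mu> a" "\<mu> > 0"
  shows "\<bar>coeff_form a X \<xi> \<zeta>\<bar> \<le> ((norm \<xi>)\<^sup>2 + (norm \<zeta>)\<^sup>2) / (2 * \<mu>)"
proof -
  have nonneg: "0 \<le> coeff_form a X \<eta> \<eta>" for \<eta>
    using coeff_form_elliptic(1)[OF assms(2), of \<eta> X] assms(3)
    by (meson mult_nonneg_nonneg order_trans less_imp_le zero_le_power2)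
  have "2 * \<bar>coeff_form a X \<xi> \<zeta>\<bar> \<le> coeff_form a X \<xi> \<xi> + coeff_form a X \<zeta> \<zeta>"
    using nonneg[of "\<xi> + \<zeta>"] nonneg[of "\<xi> - \<zeta>"] coeff_form_commute[OF assms(1), of X \<xi> \<zeta>]
    by (simp add: coeff_form_bilinear)
  also have "\<dots> \<le> ((norm \<xi>)\<^sup>2 + (norm \<zeta>)\<^sup>2) / \<mu>"
    using coeff_form_elliptic(2)[OF assms(2), of X \<xi>] coeff_form_elliptic(2)[OF assms(2), of X \<zeta>]
    by (simp add: add_divide_distrib)
  finally show ?thesis by simp
qed

lemma borel_measurable_coeff_form:
  assumes "\<And>i j. i \<in> Basis \<Longrightarrow> j \<in> Basis \<Longrightarrow> continuous_on UNIV (a i j)"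
    and [measurable]: "V \<in> borel_measurable borel" "W \<in> borel_measurable borel"
  shows "(\<lambda>X. coeff_form a X (V X) (W X)) \<in> borel_measurable borel"
  unfolding coeff_form_def
  by (intro borel_measurable_sum borel_measurable_times borel_measurable_inner
      borel_measurable_continuous_onI assms borel_measurable_const)

lemma continuous_on_coeff_form:
  assumes "\<And>i j. i \<in> Basis \<Longrightarrow> j \<in> Basis \<Longrightarrow> continuous_on UNIV (a i j)"
    and "continuous_on S V" "continuous_on S W"
  shows "continuous_on S (\<lambda>X. coeff_form a X (V X) (W X))"
  unfolding coeff_form_def
  by (intro continuous_intros assms continuous_on_subset[OF assms(1)]) auto

section \<open>Integrals of bounded functions, Fubini and translation\<close>

lemma integrable_bounded_support:
  fixes f :: "'a::euclidean_space \<Rightarrow> real"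
  assumes [measurable]: "f \<in> borel_measurable borel" and "bounded S"
    and "\<And>X. X \<notin> S \<Longrightarrow> f X = 0" and "\<And>X. X \<in> S \<Longrightarrow> \<bar>f X\<bar> \<le> M"
  shows "integrable lborel f"
proof -
  obtain r where r: "S \<subseteq> cball 0 r"
    using \<open>bounded S\<close> unfolding bounded_iff by (auto simp: subset_iff)
  show ?thesis
  proof (rule integrableI_bounded_set[where A = "cball 0 r" and B = "max 0 M"])
    show "emeasure lborel (cball (0::'a) r) < \<infinity>"
      by (rule emeasure_lborel_cball_finite)
    have "\<bar>f X\<bar> \<le> max 0 M" for X
      using assms(3,4)[of X] by (cases "X \<in> S") auto
    then show "AE X in lborel. X \<in> cball 0 r \<longrightarrow> norm (f X) \<le> max 0 M" by auto
    show "AE X in lborel. X \<notin> cball 0 r \<longrightarrow> f X = 0" using assms(3) r by blast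
  qed auto
qed

lemma integral_tendsto_bounded_support:
  fixes f :: "nat \<Rightarrow> 'a::euclidean_space \<Rightarrow> real"
  assumes [measurable]: "\<And>n. f n \<in> borel_measurable borel" and "bounded S"
    and "\<And>n X. X \<notin> S \<Longrightarrow> f n X = 0" and "\<And>n X. X \<in> S \<Longrightarrow> \<bar>f n X\<bar> \<le> M"
    and "\<And>X. (\<lambda>n. f n X) \<longlonglongrightarrow> h X"
  shows "(\<lambda>n. LINT X|lborel. f n X) \<longlonglongrightarrow> (LINT X|lborel. h X)"
proof -
  obtain r where r: "S \<subseteq> cball 0 r"
    using \<open>bounded S\<close> unfolding bounded_iff by (auto simp: subset_iff)
  have [measurable]: "h \<in> borel_measurable borel"
    by (rule borel_measurable_LIMSEQ_real[OF assms(5)]) auto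
  have "integrable lborel (\<lambda>X::'a. max 0 M * indicator (cball 0 r) X)"
    by (rule integrable_bounded_support[where S = "cball 0 r" and M = "max 0 M"])
       (auto intro!: borel_measurable_times borel_measurable_indicator)
  moreover have "\<bar>f n X\<bar> \<le> max 0 M * indicator (cball 0 r) X" for n X
    using assms(3,4)[of X n] r by (cases "X \<in> S") (auto simp: indicator_def)
  ultimately show ?thesis
    by (intro integral_dominated_convergence[where w = "\<lambda>X. max 0 M * indicator (cball 0 r) X"])
       (use assms in auto)
qed

lemma lborel_integral_fst:
  fixes f :: "'a::euclidean_space \<times> 'b::euclidean_space \<Rightarrow> real"
  assumes "integrable lborel f"
  shows "(LINT x|lborel. LINT y|lborel. f (x, y)) = (LINT X|lborel. f X)"
  using lborel_pair.integral_fst'[of f] assms by (simp add: lborel_prod)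

lemma lborel_integral_snd:
  fixes f :: "'a::euclidean_space \<times> 'b::euclidean_space \<Rightarrow> real"
  assumes "integrable lborel f"
  shows "(LINT y|lborel. LINT x|lborel. f (x, y)) = (LINT X|lborel. f X)"
  using lborel_pair.integral_snd[of "\<lambda>x y. f (x, y)"] assms by (simp add: lborel_prod)

lemma integral_translation_lborel:
  fixes f :: "'a::euclidean_space \<Rightarrow> real"
  assumes [measurable]: "f \<in> borel_measurable borel"
  shows "(LINT X|lborel. f (X + c)) = (LINT X|lborel. f X)"
proof -
  have "(LINT X|lborel. f X) = (LINT X|distr lborel borel ((+) c). f X)"
    by (simp add: lborel_distr_plus)
  also have "\<dots> = (LINT X|lborel. f (c + X))"
    by (rule integral_distr) auto
  finally show ?thesis by (simp add: add.commute)
qed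

lemma integrable_translation_lborel:
  fixes f :: "'a::euclidean_space \<Rightarrow> real"
  assumes "integrable lborel f"
  shows "integrable lborel (\<lambda>X. f (X + c))"
proof -
  have "integrable (distr lborel borel ((+) c)) f"
    using assms by (simp add: lborel_distr_plus)
  then show ?thesis
    by (subst (asm) integrable_distr_eq) (use assms in \<open>auto simp: add.commute\<close>)
qed

lemma integrable_mult_abs_le_1:
  fixes w h :: "'a \<Rightarrow> real"
  assumes "integrable M h" "w \<in> borel_measurable M" "\<And>x. \<bar>w x\<bar> \<le> 1"
  shows "integrable M (\<lambda>x. w x * h x)"
proof (rule Bochner_Integration.integrable_bound[OF assms(1)])
  show "(\<lambda>x. w x * h x) \<in> borel_measurable M" using assms(1,2) by simp
  have "\<bar>w x * h x\<bar> \<le> 1 * \<bar>h x\<bar>" for x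
    unfolding abs_mult by (rule mult_right_mono) (use assms(3) in auto)
  then show "AE x in M. norm (w x * h x) \<le> norm (h x)" by simp
qed

lemma integral_greaterThanAtMost_eq_atLeastAtMost:
  fixes f :: "real \<Rightarrow> real"
  assumes [measurable]: "f \<in> borel_measurable borel"
  shows "(LINT t|lborel. indicator {a<..b} t * f t) = (LINT t|lborel. indicator {a..b} t * f t)"
proof (rule integral_cong_AE)
  show "AE t in lborel. indicator {a<..b} t * f t = indicator {a..b} t * f t"
    using AE_lborel_singleton[of a] by eventually_elim (auto simp: indicator_def)
qed measurable

text \<open>Integrate \<open>0 \<le> (f - m)\<^sup>2\<close>, where \<open>m\<close> is the mean of \<open>f\<close>.\<close>
lemma power2_integral_unit_interval_le:
  fixes f :: "real \<Rightarrow> real"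
  assumes "continuous_on {0..1} f"
  shows "(integral {0..1} f)\<^sup>2 \<le> integral {0..1} (\<lambda>s. (f s)\<^sup>2)"
proof -
  define m where "m = integral {0..1} f"
  have "f integrable_on {0..1}" and sq: "(\<lambda>s. (f s)\<^sup>2) integrable_on {0..1}"
    by (intro integrable_continuous_interval continuous_intros assms)+
  have "((\<lambda>s. 2 * m * f s - m\<^sup>2) has_integral (2 * m * m - m\<^sup>2)) {0..1}"
  proof (intro has_integral_diff has_integral_mult_right)
    show "(f has_integral m) {0..1}"
      using \<open>f integrable_on {0..1}\<close> by (simp add: m_def has_integral_iff)
    show "((\<lambda>s::real. m\<^sup>2) has_integral m\<^sup>2) {0..1}"
      using has_integral_const_real[of "m\<^sup>2" 0 1] by simp
  qed
  then have "2 * m * m - m\<^sup>2 \<le> integral {0..1} (\<lambda>s. (f s)\<^sup>2)"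
  proof (rule has_integral_le)
    show "((\<lambda>s. (f s)\<^sup>2) has_integral integral {0..1} (\<lambda>s. (f s)\<^sup>2)) {0..1}"
      using sq by (simp add: has_integral_iff)
    show "2 * m * f s - m\<^sup>2 \<le> (f s)\<^sup>2" for s
      using zero_le_power2[of "f s - m"] by (simp add: power2_diff algebra_simps)
  qed
  then show ?thesis by (simp add: m_def power2_eq_square)
qed

section \<open>Cutting off test functions\<close>

text \<open>
  Multiplying by a cutoff \<open>\<zeta>\<close> that vanishes off a compact set \<open>Z\<close> makes a test function out of any
  \<open>q\<close> that is \<open>C\<^sup>1\<close> near \<open>Z\<close>: the product is \<open>C\<^sup>1\<close> on \<open>\<Omega>'\<close> and zero on the open complement of \<open>Z\<close>, and
  these two sets cover the space.
\<close>
lemma C1_test_with_grad_cutoff: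
  fixes \<zeta> q :: "'a::euclidean_space \<Rightarrow> real"
  assumes "open \<Omega>'" "\<Omega>' \<subseteq> \<Omega>" "compact Z" "Z \<subseteq> \<Omega>'"
    and \<zeta>: "\<And>X. GDERIV \<zeta> X :> D\<zeta> X" "continuous_on UNIV D\<zeta>"
    and vanish: "\<And>X. X \<notin> Z \<Longrightarrow> \<zeta> X = 0" "\<And>X. X \<notin> Z \<Longrightarrow> D\<zeta> X = 0"
    and q: "\<And>X. X \<in> \<Omega>' \<Longrightarrow> GDERIV q X :> Dq X" "continuous_on \<Omega>' Dq"
  shows "C1_test_with_grad \<Omega> (\<lambda>X. \<zeta> X * q X) (\<lambda>X. \<zeta> X *\<^sub>R Dq X + q X *\<^sub>R D\<zeta> X)"
  unfolding C1_test_with_grad_def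
proof (intro conjI allI)
  have "closed Z" using \<open>compact Z\<close> by (rule compact_imp_closed)
  have cover: "\<Omega>' \<union> - Z = UNIV" using \<open>Z \<subseteq> \<Omega>'\<close> by auto
  show "GDERIV (\<lambda>X. \<zeta> X * q X) X :> \<zeta> X *\<^sub>R Dq X + q X *\<^sub>R D\<zeta> X" for X
  proof (cases "X \<in> \<Omega>'")
    case True
    then show ?thesis by (intro GDERIV_mult \<zeta> q)
  next
    case False
    then have "X \<in> - Z" using \<open>Z \<subseteq> \<Omega>'\<close> by auto
    have "((\<lambda>X. \<zeta> X * q X) has_derivative (\<lambda>h. 0)) (at X)"
      by (rule has_derivative_transform_within_open[where f = "\<lambda>X. 0", OF _ open_Compl[OF \<open>closed Z\<close>] \<open>X \<in> - Z\<close>])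
         (auto simp: vanish)
    then show ?thesis using \<open>X \<in> - Z\<close> by (simp add: gderiv_def vanish)
  qed
  have "continuous_on \<Omega>' q"
    using q(1) unfolding gderiv_def
    by (meson has_derivative_at_withinI has_derivative_continuous_on)
  moreover have "continuous_on \<Omega>' \<zeta>"
    using \<zeta>(1) unfolding gderiv_def
    by (meson has_derivative_at_withinI has_derivative_continuous_on)
  ultimately have "continuous_on \<Omega>' (\<lambda>X. \<zeta> X *\<^sub>R Dq X + q X *\<^sub>R D\<zeta> X)"
    by (intro continuous_intros q continuous_on_subset[OF \<zeta>(2)]) auto
  moreover have "continuous_on (- Z) (\<lambda>X. \<zeta> X *\<^sub>R Dq X + q X *\<^sub>R D\<zeta> X)"
    by (rule continuous_on_eq[where f = "\<lambda>X. 0"]) (auto simp: vanish)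
  ultimately have "continuous_on (\<Omega>' \<union> - Z) (\<lambda>X. \<zeta> X *\<^sub>R Dq X + q X *\<^sub>R D\<zeta> X)"
    using \<open>open \<Omega>'\<close> open_Compl[OF \<open>closed Z\<close>] by (intro continuous_on_open_Un)
  then show "continuous_on UNIV (\<lambda>X. \<zeta> X *\<^sub>R Dq X + q X *\<^sub>R D\<zeta> X)"
    by (simp only: cover)
  have "closure {X. \<zeta> X * q X \<noteq> 0} \<subseteq> Z"
    using vanish(1) \<open>closed Z\<close> by (intro closure_minimal) auto
  then show "closure {X. \<zeta> X * q X \<noteq> 0} \<subseteq> \<Omega>" "compact (closure {X. \<zeta> X * q X \<noteq> 0})"
    using assms(2-4) compact_Int_closed[of Z "closure {X. \<zeta> X * q X \<noteq> 0}"]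
    by (auto simp: inf.absorb2)
qed

section \<open>Green's identity for the vertical difference\<close>

text \<open>
  Continuity of the coefficients makes the integrands measurable and, with that of the gradient, gives
  the conormal derivative its boundary values. The bound \<open>R > 1\<close> says that a vertical step of length one
  from height \<open>2R\<close> stays below \<open>3R\<close>, and that the cutoff in \<open>t\<close> is one on the slab \<open>0 < t \<le> 1\<close>.
\<close>
locale neumann_cylinder =
  fixes a :: "(real ^ 'd) \<times> real \<Rightarrow> (real ^ 'd) \<times> real \<Rightarrow> (real ^ 'd) \<times> real \<Rightarrow> real"
    and \<mu> R :: real and x\<^sub>0 :: "real ^ 'd"
    and u :: "(real ^ 'd) \<times> real \<Rightarrow> real"
    and Du :: "(real ^ 'd) \<times> real \<Rightarrow> (real ^ 'd) \<times> real"
    and g :: "real ^ 'd \<Rightarrow> real"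
  assumes coeffs_continuous: "\<And>i j. i \<in> Basis \<Longrightarrow> j \<in> Basis \<Longrightarrow> continuous_on UNIV (a i j)"
    and symmetric: "symmetric_coeffs a"
    and elliptic: "elliptic_coeffs \<mu> a"
    and periodic: "\<And>i j x t. i \<in> Basis \<Longrightarrow> j \<in> Basis \<Longrightarrow> a i j (x, t + 1) = a i j (x, t)"
    and \<mu>_pos: "\<mu> > 0"
    and R_gt_1: "R > 1"
    and C1: "C1_closure_with_grad (T_cyl x\<^sub>0 (3 * R)) u Du"
    and weak: "weak_solution a (T_cyl x\<^sub>0 (3 * R)) Du"
    and neumann: "\<And>x. x \<in> ball x\<^sub>0 (3 * R) \<Longrightarrow> conormal_deriv a Du (0, -1) (x, 0) = g x"
begin

abbreviation up :: "(real ^ 'd) \<times> real" where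
  "up \<equiv> (0, 1)"

abbreviation form where
  "form \<equiv> coeff_form a"

text \<open>
  \<open>K\<close> is the closed cylinder and \<open>K'\<close> the part of it that a unit step upwards keeps inside. Extending
  the gradient and the vertical difference by zero outside these compact sets makes them bounded Borel
  functions on the whole space, and all integrals below become integrals of such functions. Both sets
  contain the bottom \<open>t = 0\<close>, where the boundary values are taken.
\<close>
definition K :: "((real ^ 'd) \<times> real) set" where
  "K = cball x\<^sub>0 (3 * R) \<times> {0..3 * R}"

definition K' :: "((real ^ 'd) \<times> real) set" where
  "K' = cball x\<^sub>0 (3 * R) \<times> {0..3 * R - 1}"

definition D :: "(real ^ 'd) \<times> real \<Rightarrow> (real ^ 'd) \<times> real" where
  "D X = indicator K X *\<^sub>R Du X"

definition q :: "(real ^ 'd) \<times> real \<Rightarrow> real" where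
  "q X = indicator K' X *\<^sub>R (u (X + up) - u X)"

text \<open>
  The cutoffs \<open>\<alpha>\<close> and \<open>\<beta>\<close> fall from one to zero between the radii, respectively the heights, \<open>R\<close> and
  \<open>2R\<close>. The squared distance in \<open>\<alpha>\<close> avoids the singularity of the norm at the centre.
\<close>
definition \<alpha> :: "real ^ 'd \<Rightarrow> real" where
  "\<alpha> x = smoothstep ((4 * R\<^sup>2 - (norm (x - x\<^sub>0))\<^sup>2) / (3 * R\<^sup>2))"

definition D\<alpha> :: "real ^ 'd \<Rightarrow> real ^ 'd" where
  "D\<alpha> x = smoothstep_deriv ((4 * R\<^sup>2 - (norm (x - x\<^sub>0))\<^sup>2) / (3 * R\<^sup>2)) *\<^sub>R
           (- 2 / (3 * R\<^sup>2)) *\<^sub>R (x - x\<^sub>0)"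

definition \<beta> :: "real \<Rightarrow> real" where
  "\<beta> t = smoothstep (2 - t / R)"

definition \<beta>' :: "real \<Rightarrow> real" where
  "\<beta>' t = - smoothstep_deriv (2 - t / R) / R"

text \<open>
  The two parts of the weak formulation when the test function is \<open>\<alpha>(x) \<gamma>(t) q(x, t)\<close>: the factor of
  \<open>\<gamma>\<close> is \<open>bulk\<close> and the factor of \<open>\<gamma>'\<close> is \<open>flux\<close>. At \<open>t = 0\<close> the latter is, up to sign, the product of
  \<open>\<alpha>\<close>, \<open>q\<close> and the conormal derivative.
\<close>
definition bulk :: "(real ^ 'd) \<times> real \<Rightarrow> real" where
  "bulk X = \<alpha> (fst X) * form X (D X) (D (X + up) - D X) + q X * form X (D X) (D\<alpha> (fst X), 0)"

definition flux :: "(real ^ 'd) \<times> real \<Rightarrow> real" where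
  "flux X = \<alpha> (fst X) * q X * form X (D X) up"

subsection \<open>The cutoff functions\<close>

lemma R_pos: "R > 0"
  using R_gt_1 by simp

lemma GDERIV_\<alpha>: "GDERIV \<alpha> x :> D\<alpha> x"
proof -
  have "((\<lambda>x. (norm (x - x\<^sub>0))\<^sup>2) has_derivative (\<lambda>h. 2 * ((x - x\<^sub>0) \<bullet> h))) (at x)"
    unfolding power2_norm_eq_inner
    by (auto intro!: derivative_eq_intros simp: inner_commute)
  then have "((\<lambda>x. (4 * R\<^sup>2 - (norm (x - x\<^sub>0))\<^sup>2) / (3 * R\<^sup>2)) has_derivative
      (\<lambda>h. (0 - 2 * ((x - x\<^sub>0) \<bullet> h)) / (3 * R\<^sup>2))) (at x)"
    by (intro bounded_linear.has_derivative[OF bounded_linear_divide] has_derivative_diff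
        has_derivative_const)
  then have "GDERIV (\<lambda>x. (4 * R\<^sup>2 - (norm (x - x\<^sub>0))\<^sup>2) / (3 * R\<^sup>2)) x :>
      (- 2 / (3 * R\<^sup>2)) *\<^sub>R (x - x\<^sub>0)"
    unfolding gderiv_def by (simp add: inner_commute)
  from GDERIV_DERIV_compose[OF this has_real_derivative_smoothstep]
  show ?thesis by (simp add: \<alpha>_def[abs_def] D\<alpha>_def)
qed

lemma continuous_D\<alpha>: "continuous_on A D\<alpha>"
  unfolding D\<alpha>_def
  by (intro continuous_intros continuous_on_compose2[OF continuous_smoothstep_deriv[of UNIV]])
     (use R_pos in auto)

lemma continuous_\<alpha>: "continuous_on A \<alpha>"
  unfolding \<alpha>_def
  by (intro continuous_intros continuous_on_compose2[OF continuous_smoothstep[of UNIV]])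
     (use R_pos in auto)

lemma \<alpha>_bounds: "0 \<le> \<alpha> x" "\<alpha> x \<le> 1"
  by (simp_all add: \<alpha>_def smoothstep_bounds)

lemma \<alpha>_argument:
  "dist x x\<^sub>0 \<le> R \<Longrightarrow> (4 * R\<^sup>2 - (norm (x - x\<^sub>0))\<^sup>2) / (3 * R\<^sup>2) \<ge> 1"
  "dist x x\<^sub>0 \<ge> 2 * R \<Longrightarrow> (4 * R\<^sup>2 - (norm (x - x\<^sub>0))\<^sup>2) / (3 * R\<^sup>2) \<le> 0"
proof -
  assume "dist x x\<^sub>0 \<le> R"
  then have "(norm (x - x\<^sub>0))\<^sup>2 \<le> R\<^sup>2" by (simp add: dist_norm power_mono)
  then show "(4 * R\<^sup>2 - (norm (x - x\<^sub>0))\<^sup>2) / (3 * R\<^sup>2) \<ge> 1"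
    using R_pos by (simp add: field_simps)
next
  assume "dist x x\<^sub>0 \<ge> 2 * R"
  then have "(2 * R)\<^sup>2 \<le> (norm (x - x\<^sub>0))\<^sup>2" using R_pos by (intro power_mono) (auto simp: dist_norm)
  then show "(4 * R\<^sup>2 - (norm (x - x\<^sub>0))\<^sup>2) / (3 * R\<^sup>2) \<le> 0"
    using R_pos by (simp add: power_mult_distrib divide_nonpos_pos)
qed

lemma \<alpha>_eq_1: "dist x x\<^sub>0 \<le> R \<Longrightarrow> \<alpha> x = 1"
  and \<alpha>_eq_0: "dist x x\<^sub>0 \<ge> 2 * R \<Longrightarrow> \<alpha> x = 0"
  and D\<alpha>_eq_0: "dist x x\<^sub>0 \<le> R \<or> dist x x\<^sub>0 \<ge> 2 * R \<Longrightarrow> D\<alpha> x = 0"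
  using \<alpha>_argument[of x]
  by (auto simp: \<alpha>_def D\<alpha>_def smoothstep_eq_1 smoothstep_eq_0 smoothstep_deriv_eq_0)

lemma norm_D\<alpha>_le: "norm (D\<alpha> x) \<le> 8 / (3 * R)"
proof (cases "dist x x\<^sub>0 \<ge> 2 * R")
  case True
  then show ?thesis using R_pos by (simp add: D\<alpha>_eq_0)
next
  case False
  then have "norm (D\<alpha> x) \<le> 2 * (2 / (3 * R\<^sup>2) * (2 * R))"
    unfolding D\<alpha>_def norm_scaleR
    by (intro mult_mono) (use R_pos smoothstep_deriv_bounds in \<open>auto simp: dist_norm\<close>)
  also have "\<dots> = 8 / (3 * R)" using R_pos by (simp add: power2_eq_square)
  finally show ?thesis .
qed

lemma \<beta>_deriv: "(\<beta> has_real_derivative \<beta>' t) (at t)"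
  unfolding \<beta>_def[abs_def] \<beta>'_def
  by (rule DERIV_cong[OF DERIV_chain2[OF has_real_derivative_smoothstep]])
     (use R_pos in \<open>auto intro!: derivative_eq_intros\<close>)

lemma continuous_\<beta>': "continuous_on A \<beta>'"
  unfolding \<beta>'_def
  by (intro continuous_intros continuous_on_compose2[OF continuous_smoothstep_deriv[of UNIV]])
     (use R_pos in auto)

lemma continuous_\<beta>: "continuous_on A \<beta>"
  unfolding \<beta>_def
  by (intro continuous_intros continuous_on_compose2[OF continuous_smoothstep[of UNIV]])
     (use R_pos in auto)

lemma \<beta>_bounds: "0 \<le> \<beta> t" "\<beta> t \<le> 1"
  by (simp_all add: \<beta>_def smoothstep_bounds)

lemma \<beta>_eq_1: "t \<le> R \<Longrightarrow> \<beta> t = 1"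
  and \<beta>_eq_0: "t \<ge> 2 * R \<Longrightarrow> \<beta> t = 0"
  and \<beta>'_eq_0: "t \<le> R \<or> t \<ge> 2 * R \<Longrightarrow> \<beta>' t = 0"
  using R_pos by (auto simp: \<beta>_def \<beta>'_def field_simps intro!: smoothstep_eq_1 smoothstep_eq_0
      smoothstep_deriv_eq_0)

lemma abs_\<beta>'_le: "\<bar>\<beta>' t\<bar> \<le> 2 / R"
  using smoothstep_deriv_bounds[of "2 - t / R"] R_pos
  by (simp add: \<beta>'_def divide_right_mono)

text \<open>
  The weight left over after telescoping in \<open>t\<close> is small, because \<open>\<beta>\<close> has slope of order \<open>1/R\<close>.
\<close>
lemma \<beta>_shift_le: "\<beta> (t - 1) - \<beta> t \<le> 2 / R"
proof -
  have "smoothstep (2 - (t - 1) / R) - smoothstep (2 - t / R)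
      \<le> 2 * ((2 - (t - 1) / R) - (2 - t / R))"
    by (rule smoothstep_lipschitz) (use R_pos in \<open>simp add: divide_right_mono\<close>)
  also have "\<dots> = 2 / R" by (simp add: diff_divide_distrib)
  finally show ?thesis by (simp add: \<beta>_def)
qed

subsection \<open>The extended gradient and the vertical difference\<close>

lemma closure_cylinder: "closure (T_cyl x\<^sub>0 (3 * R)) = K"
  using R_pos by (simp add: T_cyl_def K_def closure_Times)

lemma continuous_u: "continuous_on K u"
  and continuous_Du: "continuous_on K Du"
  and GDERIV_u: "X \<in> T_cyl x\<^sub>0 (3 * R) \<Longrightarrow> GDERIV u X :> Du X"
  using C1 unfolding C1_closure_with_grad_def closure_cylinder by auto

lemma compact_K: "compact K" and compact_K': "compact K'"
  unfolding K_def K'_def by (intro compact_Times compact_cball compact_Icc)+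

lemma K'_subset: "X \<in> K' \<Longrightarrow> X \<in> K" "X \<in> K' \<Longrightarrow> X + up \<in> K"
  by (auto simp: K_def K'_def)

lemma continuous_D: "continuous_on K D"
  by (rule continuous_on_eq[OF continuous_Du]) (simp add: D_def)

lemma continuous_q: "continuous_on K' q"
proof -
  have "continuous_on K' (\<lambda>X. u (X + up) - u X)"
    by (intro continuous_intros continuous_on_compose2[OF continuous_u]) (auto dest: K'_subset)
  then show ?thesis
    by (rule continuous_on_eq) (simp add: q_def)
qed

lemma D_measurable [measurable]: "D \<in> borel_measurable borel"
  unfolding D_def[abs_def]
  by (rule borel_measurable_continuous_on_indicator)
     (use compact_K continuous_Du in \<open>auto intro: borel_compact\<close>)

lemma q_measurable [measurable]: "q \<in> borel_measurable borel"
proof -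
  have "(\<lambda>X. indicator K' X *\<^sub>R q X) \<in> borel_measurable borel"
    by (rule borel_measurable_continuous_on_indicator)
       (use compact_K' continuous_q in \<open>auto intro: borel_compact\<close>)
  moreover have "(\<lambda>X. indicator K' X *\<^sub>R q X) = q"
    by (auto simp: q_def indicator_def)
  ultimately show ?thesis by simp
qed

lemma \<alpha>_measurable [measurable]: "\<alpha> \<in> borel_measurable borel"
  and D\<alpha>_measurable [measurable]: "D\<alpha> \<in> borel_measurable borel"
  and \<beta>_measurable [measurable]: "\<beta> \<in> borel_measurable borel"
  and \<beta>'_measurable [measurable]: "\<beta>' \<in> borel_measurable borel"
  by (intro borel_measurable_continuous_onI continuous_\<alpha> continuous_D\<alpha> continuous_\<beta> continuous_\<beta>')+

lemma form_measurable:
  "V \<in> borel_measurable borel \<Longrightarrow> W \<in> borel_measurable borel \<Longrightarrow>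
    (\<lambda>X. form X (V X) (W X)) \<in> borel_measurable borel"
  by (rule borel_measurable_coeff_form[OF coeffs_continuous])

lemma fst_snd_borel [measurable]:
  "(fst :: (real ^ 'd) \<times> real \<Rightarrow> _) \<in> borel_measurable borel"
  "(snd :: (real ^ 'd) \<times> real \<Rightarrow> _) \<in> borel_measurable borel"
  by (intro borel_measurable_continuous_onI continuous_intros)+

lemma bulk_measurable [measurable]: "bulk \<in> borel_measurable borel"
proof -
  have [measurable]: "(\<lambda>X. (D\<alpha> (fst X), 0)) \<in> borel \<rightarrow>\<^sub>M (borel :: ((real ^ 'd) \<times> real) measure)"
    by (intro borel_measurable_continuous_onI continuous_intros
        continuous_on_compose2[OF continuous_D\<alpha>[of UNIV]]) auto
  have [measurable]: "(\<lambda>X. form X (D X) (D (X + up) - D X)) \<in> borel_measurable borel"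
    "(\<lambda>X. form X (D X) (D\<alpha> (fst X), 0)) \<in> borel_measurable borel"
    by (intro form_measurable; measurable)+
  show ?thesis unfolding bulk_def[abs_def] by measurable
qed

lemma flux_measurable [measurable]: "flux \<in> borel_measurable borel"
proof -
  have [measurable]: "(\<lambda>X. form X (D X) up) \<in> borel_measurable borel"
    by (intro form_measurable; measurable)
  show ?thesis unfolding flux_def[abs_def] by measurable
qed

lemma D_bounded: "\<exists>M. \<forall>X. norm (D X) \<le> M"
proof -
  obtain M where "\<And>X. X \<in> K \<Longrightarrow> norm (D X) \<le> M"
    using compact_imp_bounded[OF compact_continuous_image[OF continuous_D compact_K]]
    unfolding bounded_iff by auto
  then have "norm (D X) \<le> max 0 M" for X
    by (cases "X \<in> K") (auto simp: D_def le_max_iff_disj)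
  then show ?thesis by blast
qed

lemma q_bounded: "\<exists>M. \<forall>X. \<bar>q X\<bar> \<le> M"
proof -
  obtain M where "\<And>X. X \<in> K' \<Longrightarrow> \<bar>q X\<bar> \<le> M"
    using compact_imp_bounded[OF compact_continuous_image[OF continuous_q compact_K']]
    unfolding bounded_iff by auto
  then have "\<bar>q X\<bar> \<le> max 0 M" for X
    by (cases "X \<in> K'") (auto simp: q_def le_max_iff_disj)
  then show ?thesis by blast
qed

lemma form_bounded:
  assumes "norm \<xi> \<le> M" "norm \<zeta> \<le> N"
  shows "\<bar>form X \<xi> \<zeta>\<bar> \<le> (M\<^sup>2 + N\<^sup>2) / (2 * \<mu>)"
proof -
  have "(norm \<xi>)\<^sup>2 \<le> M\<^sup>2" "(norm \<zeta>)\<^sup>2 \<le> N\<^sup>2"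
    using assms by (auto intro: power_mono)
  then show ?thesis
    using abs_coeff_form_le[OF symmetric elliptic \<mu>_pos, of X \<xi> \<zeta>] \<mu>_pos
      divide_right_mono[of "(norm \<xi>)\<^sup>2 + (norm \<zeta>)\<^sup>2" "M\<^sup>2 + N\<^sup>2" "2 * \<mu>"] by linarith
qed

lemma bulk_bounded: "\<exists>M. \<forall>X. \<bar>bulk X\<bar> \<le> M"
proof -
  obtain M where M: "\<And>X. norm (D X) \<le> M" using D_bounded by blast
  obtain N where N: "\<And>X. \<bar>q X\<bar> \<le> N" using q_bounded by blast
  have "norm (D (X + up) - D X) \<le> M + M" for X
    using norm_triangle_ineq4[of "D (X + up)" "D X"] M[of X] M[of "X + up"] by linarith
  then have 1: "\<bar>form X (D X) (D (X + up) - D X)\<bar> \<le> (M\<^sup>2 + (M + M)\<^sup>2) / (2 * \<mu>)" for X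
    by (intro form_bounded M)
  have 2: "\<bar>form X (D X) (D\<alpha> (fst X), 0)\<bar> \<le> (M\<^sup>2 + (8 / (3 * R))\<^sup>2) / (2 * \<mu>)" for X
    by (intro form_bounded M) (simp add: norm_D\<alpha>_le)
  have "\<bar>bulk X\<bar> \<le> 1 * ((M\<^sup>2 + (M + M)\<^sup>2) / (2 * \<mu>)) + N * ((M\<^sup>2 + (8 / (3 * R))\<^sup>2) / (2 * \<mu>))" for X
    unfolding bulk_def
    by (rule order_trans[OF abs_triangle_ineq], unfold abs_mult, intro add_mono mult_mono 1 2 N)
       (use \<alpha>_bounds N[of X] in auto)
  then show ?thesis by blast
qed

lemma flux_bounded: "\<exists>M. \<forall>X. \<bar>flux X\<bar> \<le> M"
proof -
  obtain M where M: "\<And>X. norm (D X) \<le> M" using D_bounded by blast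
  obtain N where N: "\<And>X. \<bar>q X\<bar> \<le> N" using q_bounded by blast
  have 1: "\<bar>form X (D X) up\<bar> \<le> (M\<^sup>2 + 1\<^sup>2) / (2 * \<mu>)" for X
    by (intro form_bounded M) simp
  have "\<bar>flux X\<bar> \<le> 1 * N * ((M\<^sup>2 + 1\<^sup>2) / (2 * \<mu>))" for X
    unfolding flux_def abs_mult
    by (intro mult_mono 1 N) (use \<alpha>_bounds N[of X] in auto)
  then show ?thesis by blast
qed

lemma outside_K_eq_0:
  assumes "X \<notin> K"
  shows "D X = 0" "bulk X = 0" "flux X = 0"
  using assms by (simp_all add: D_def bulk_def flux_def coeff_form_bilinear)

text \<open>
  Periodicity, in the form used below: the energy at \<open>X + up\<close> can be computed with the coefficients
  at \<open>X\<close>.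
\<close>
lemma form_shift: "form (X + up) = form X"
  using periodic by (cases X) (simp add: coeff_form_def fun_eq_iff)

lemma continuous_flux: "continuous_on K' flux"
  unfolding flux_def
  by (intro continuous_intros continuous_on_coeff_form coeffs_continuous continuous_q
      continuous_on_subset[OF continuous_D] continuous_on_compose2[OF continuous_\<alpha>[of UNIV]])
     (auto dest: K'_subset)

subsection \<open>Testing the equation\<close>

text \<open>
  The test function is \<open>\<alpha>(x) \<gamma>(t) q(x, t)\<close>. Its support is confined by \<open>\<alpha>\<close> and \<open>\<gamma>\<close> to radius and
  height at most \<open>2R\<close>, where \<open>q\<close> is \<open>C\<^sup>1\<close> because the point one unit higher still lies in the cylinder,
  and \<open>\<epsilon>\<close> keeps it away from the bottom, as the weak formulation in the open cylinder requires.
\<close>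
lemma weak_identity:
  fixes \<gamma> \<gamma>' :: "real \<Rightarrow> real"
  assumes \<gamma>: "\<And>t. (\<gamma> has_real_derivative \<gamma>' t) (at t)" "continuous_on UNIV \<gamma>'" and "\<epsilon> > 0"
    and vanish: "\<And>t. t \<notin> {\<epsilon>..2 * R} \<Longrightarrow> \<gamma> t = 0 \<and> \<gamma>' t = 0"
  shows "(LINT X|lborel. \<gamma> (snd X) * bulk X + \<gamma>' (snd X) * flux X) = 0"
proof -
  define \<zeta> where "\<zeta> X = \<alpha> (fst X) * \<gamma> (snd X)" for X :: "(real ^ 'd) \<times> real"
  define D\<zeta> where "D\<zeta> X = (\<gamma> (snd X) *\<^sub>R D\<alpha> (fst X), \<alpha> (fst X) * \<gamma>' (snd X))"
    for X :: "(real ^ 'd) \<times> real"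
  define \<Omega>' where "\<Omega>' = ball x\<^sub>0 (3 * R) \<times> {0<..<3 * R - 1}"
  define Z where "Z = cball x\<^sub>0 (2 * R) \<times> {\<epsilon>..2 * R}"
  let ?\<Omega> = "T_cyl x\<^sub>0 (3 * R)"
  have sub: "Z \<subseteq> \<Omega>'" "\<Omega>' \<subseteq> ?\<Omega>" "\<Omega>' \<subseteq> K'"
    using R_gt_1 \<open>\<epsilon> > 0\<close> by (auto simp: Z_def \<Omega>'_def T_cyl_def K'_def)
  have test: "C1_test_with_grad ?\<Omega> (\<lambda>X. \<zeta> X * q X)
      (\<lambda>X. \<zeta> X *\<^sub>R (D (X + up) - D X) + q X *\<^sub>R D\<zeta> X)"
  proof (rule C1_test_with_grad_cutoff[of \<Omega>' _ Z])
    show "open \<Omega>'" unfolding \<Omega>'_def by (intro open_Times open_ball open_greaterThanLessThan)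
    show "\<Omega>' \<subseteq> ?\<Omega>" "Z \<subseteq> \<Omega>'" by fact+
    show "compact Z" unfolding Z_def by (intro compact_Times compact_cball compact_Icc)
    show "GDERIV \<zeta> X :> D\<zeta> X" for X
    proof -
      have 1: "((\<lambda>X. \<alpha> (fst X)) has_derivative (\<lambda>h. fst h \<bullet> D\<alpha> (fst X))) (at X)"
        by (rule has_derivative_compose[OF has_derivative_fst[OF has_derivative_ident]
              GDERIV_\<alpha>[unfolded gderiv_def]])
      have 2: "((\<lambda>X. \<gamma> (snd X)) has_derivative (\<lambda>h. \<gamma>' (snd X) * snd h)) (at X)"
        by (rule has_derivative_compose[OF has_derivative_snd[OF has_derivative_ident]
              \<gamma>(1)[unfolded has_field_derivative_def]])
      show ?thesis
        unfolding gderiv_def \<zeta>_def[abs_def]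
        by (rule has_derivative_eq_rhs[OF has_derivative_mult[OF 1 2]])
           (auto simp: D\<zeta>_def inner_prod_def algebra_simps)
    qed
    show "continuous_on UNIV D\<zeta>"
      unfolding D\<zeta>_def
      by (intro continuous_intros continuous_on_compose2[OF continuous_D\<alpha>[of UNIV]]
          continuous_on_compose2[OF continuous_\<alpha>[of UNIV]] continuous_on_compose2[OF \<gamma>(2)]
          continuous_on_compose2[OF DERIV_continuous_on[OF \<gamma>(1)], of UNIV]) auto
    show "\<zeta> X = 0" "D\<zeta> X = 0" if "X \<notin> Z" for X
      using that vanish[of "snd X"]
      by (auto simp: Z_def \<zeta>_def D\<zeta>_def \<alpha>_eq_0 D\<alpha>_eq_0 mem_Times_iff dist_commute
          zero_prod_def not_le)
    show "continuous_on \<Omega>' (\<lambda>X. D (X + up) - D X)"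
      by (intro continuous_intros continuous_on_compose2[OF continuous_D]
          continuous_on_subset[OF continuous_D]) (use sub K'_subset in auto)
    show "GDERIV q X :> D (X + up) - D X" if "X \<in> \<Omega>'" for X
    proof -
      have in_\<Omega>: "X \<in> ?\<Omega>" "X + up \<in> ?\<Omega>" and in_K: "X \<in> K" "X + up \<in> K"
        using that sub K'_subset by (auto simp: \<Omega>'_def T_cyl_def)
      have "((\<lambda>X. u (X + up)) has_derivative (\<lambda>h. h \<bullet> Du (X + up))) (at X)"
        using GDERIV_u[OF in_\<Omega>(2)] unfolding gderiv_def
        by (rule has_derivative_compose[rotated]) (auto intro!: derivative_eq_intros)
      from has_derivative_diff[OF this GDERIV_u[OF in_\<Omega>(1), unfolded gderiv_def]]
      have "((\<lambda>X. u (X + up) - u X) has_derivative (\<lambda>h. h \<bullet> (D (X + up) - D X))) (at X)"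
        using in_K by (simp add: D_def inner_diff_right)
      then show ?thesis
        unfolding gderiv_def
        by (rule has_derivative_transform_within_open[OF _ _ that])
           (use sub in \<open>auto simp: q_def \<Omega>'_def intro!: open_Times\<close>)
    qed
  qed
  have "(LINT X|lborel. \<gamma> (snd X) * bulk X + \<gamma>' (snd X) * flux X)
      = (LINT X:?\<Omega>|lborel. form X (Du X) (\<zeta> X *\<^sub>R (D (X + up) - D X) + q X *\<^sub>R D\<zeta> X))"
    unfolding set_lebesgue_integral_def
  proof (rule Bochner_Integration.integral_cong[OF refl])
    fix X :: "(real ^ 'd) \<times> real"
    show "\<gamma> (snd X) * bulk X + \<gamma>' (snd X) * flux X
      = indicator ?\<Omega> X *\<^sub>R form X (Du X) (\<zeta> X *\<^sub>R (D (X + up) - D X) + q X *\<^sub>R D\<zeta> X)"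
    proof (cases "X \<in> ?\<Omega>")
      case True
      then have "X \<in> K" by (auto simp: T_cyl_def K_def)
      then have "Du X = D X" by (simp add: D_def)
      moreover have "D\<zeta> X = \<gamma> (snd X) *\<^sub>R (D\<alpha> (fst X), 0) + (\<alpha> (fst X) * \<gamma>' (snd X)) *\<^sub>R up"
        by (simp add: D\<zeta>_def)
      ultimately show ?thesis
        using True
        by (simp add: \<zeta>_def bulk_def flux_def coeff_form_bilinear del: scaleR_Pair add_Pair)
           (simp add: algebra_simps)
    next
      case False
      then have "X \<notin> Z" using sub by auto
      have "\<gamma> (snd X) = 0 \<and> \<gamma>' (snd X) = 0 \<or> dist (fst X) x\<^sub>0 \<ge> 2 * R"
        using \<open>X \<notin> Z\<close> vanish[of "snd X"] by (auto simp: Z_def mem_Times_iff dist_commute)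
      then show ?thesis
        using False by (auto simp: bulk_def flux_def \<alpha>_eq_0 D\<alpha>_eq_0 coeff_form_bilinear
            simp flip: zero_prod_def)
    qed
  qed
  also have "\<dots> = 0"
    using weak test unfolding weak_solution_def coeff_form_def by blast
  finally show ?thesis .
qed

subsection \<open>Passage to the boundary\<close>

lemma bounded_K: "bounded K"
  using compact_K by (rule compact_imp_bounded)

text \<open>
  Apply \<open>weak_identity\<close> with \<open>\<gamma> = \<beta> \<theta>\<^sub>n\<close>, where \<open>\<theta>\<^sub>n\<close> rises from zero to one between the heights
  \<open>1/(n + 1)\<close> and \<open>2/(n + 1)\<close>. The terms without \<open>\<theta>\<^sub>n'\<close> converge by dominated convergence. In the term
  with \<open>\<theta>\<^sub>n'\<close>, which is unbounded, the substitution \<open>t = (1 + s)/(n + 1)\<close> produces bounded integrands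
  that converge to \<open>smoothstep_deriv s\<close> times the boundary value of \<open>flux\<close>.
\<close>
lemma green_identity:
  "(LINT X|lborel. indicator {0<..} (snd X) * (\<beta> (snd X) * bulk X + \<beta>' (snd X) * flux X))
    + (LINT x|lborel. flux (x, 0)) = 0"
proof -
  define N where "N n = real (Suc n)" for n
  define \<theta> where "\<theta> n t = smoothstep (N n * t - 1)" for n t
  define \<theta>' where "\<theta>' n t = N n * smoothstep_deriv (N n * t - 1)" for n t
  \<comment> \<open>The terms with \<open>\<theta> n\<close>, the term with its derivative, and the latter after the substitution.\<close>
  define F where "F n X = \<theta> n (snd X) * (\<beta> (snd X) * bulk X + \<beta>' (snd X) * flux X)"
    for n and X :: "(real ^ 'd) \<times> real"
  define G where "G n X = \<theta>' n (snd X) * \<beta> (snd X) * flux X" for n and X :: "(real ^ 'd) \<times> real"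
  define H where "H n X = smoothstep_deriv (snd X) *
      (\<beta> ((1 + snd X) / N n) * flux (fst X, (1 + snd X) / N n))"
    for n and X :: "(real ^ 'd) \<times> real"
  obtain Mb where Mb: "\<And>X. \<bar>bulk X\<bar> \<le> Mb" using bulk_bounded by blast
  obtain Mf where Mf: "\<And>X. \<bar>flux X\<bar> \<le> Mf" using flux_bounded by blast
  have "Mb \<ge> 0" "Mf \<ge> 0" using Mb[of 0] Mf[of 0] by auto
  have N: "N n \<ge> 1" "N n > 0" for n by (simp_all add: N_def)
  have \<theta>_deriv: "(\<theta> n has_real_derivative \<theta>' n t) (at t)" for n t
    unfolding \<theta>_def[abs_def] \<theta>'_def
    by (rule DERIV_cong[OF DERIV_chain2[OF has_real_derivative_smoothstep]])
       (auto intro!: derivative_eq_intros)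
  have \<theta>'_cont: "continuous_on A (\<theta>' n)" for n A
    unfolding \<theta>'_def
    by (intro continuous_intros continuous_on_compose2[OF continuous_smoothstep_deriv[of UNIV]]) auto
  have \<theta>_cont: "continuous_on A (\<theta> n)" for n A
    unfolding \<theta>_def
    by (intro continuous_intros continuous_on_compose2[OF continuous_smoothstep[of UNIV]]) auto
  have [measurable]: "\<theta> n \<in> borel_measurable borel" "\<theta>' n \<in> borel_measurable borel"
    "smoothstep_deriv \<in> borel_measurable borel" for n
    by (intro borel_measurable_continuous_onI \<theta>_cont \<theta>'_cont continuous_smoothstep_deriv)+
  have [measurable]: "F n \<in> borel_measurable borel" "G n \<in> borel_measurable borel" for n
    unfolding F_def[abs_def] G_def[abs_def] by measurable
  have [measurable]: "(\<lambda>X::(real ^ 'd) \<times> real. (fst X, (1 + snd X) / N n)) \<in> borel \<rightarrow>\<^sub>M borel" for n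
    by (intro borel_measurable_continuous_onI continuous_intros) (use N[of n] in auto)
  have [measurable]: "H n \<in> borel_measurable borel" for n
    unfolding H_def[abs_def] by measurable

  have F_bound: "\<bar>F n X\<bar> \<le> 1 * (1 * Mb + 2 / R * Mf)" for n X
    unfolding F_def abs_mult
    by (rule mult_mono, simp add: \<theta>_def smoothstep_bounds,
        rule order_trans[OF abs_triangle_ineq], unfold abs_mult,
        intro add_mono mult_mono Mb Mf abs_\<beta>'_le)
       (use \<beta>_bounds \<open>Mf \<ge> 0\<close> \<open>Mb \<ge> 0\<close> R_pos in auto)
  have G_bound: "\<bar>G n X\<bar> \<le> N n * 2 * 1 * Mf" for n X
    unfolding G_def abs_mult \<theta>'_def
    by (intro mult_mono Mf) (use \<beta>_bounds \<open>Mf \<ge> 0\<close> N[of n] smoothstep_deriv_bounds in auto)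
  have H_bound: "\<bar>H n X\<bar> \<le> 2 * (1 * Mf)" for n X
    unfolding H_def abs_mult
    by (intro mult_mono Mf) (use \<beta>_bounds \<open>Mf \<ge> 0\<close> smoothstep_deriv_bounds in auto)
  have F_supp: "F n X = 0" and G_supp: "G n X = 0" if "X \<notin> K" for n X
    using outside_K_eq_0[OF that] by (simp_all add: F_def G_def)
  have H_supp: "H n X = 0" if "X \<notin> cball x\<^sub>0 (2 * R) \<times> {0..1}" for n X
    using that by (auto simp: H_def mem_Times_iff smoothstep_deriv_eq_0 flux_def \<alpha>_eq_0 dist_commute)
  have H_bounded_supp: "bounded (cball x\<^sub>0 (2 * R) \<times> {0..1::real})"
    by (intro bounded_Times bounded_cball bounded_closed_interval)

  have sum_0: "(LINT X|lborel. F n X) + (LINT X|lborel. G n X) = 0" for n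
  proof -
    have "integrable lborel (F n)" "integrable lborel (G n)"
      by (rule integrable_bounded_support[OF _ bounded_K]; use F_bound F_supp G_bound G_supp in measurable)+
    then have "(LINT X|lborel. F n X) + (LINT X|lborel. G n X) = (LINT X|lborel. F n X + G n X)"
      by simp
    also have "\<dots> = (LINT X|lborel. (\<beta> (snd X) * \<theta> n (snd X)) * bulk X +
        (\<beta>' (snd X) * \<theta> n (snd X) + \<theta>' n (snd X) * \<beta> (snd X)) * flux X)"
      by (simp add: F_def G_def algebra_simps)
    also have "\<dots> = 0"
    proof (rule weak_identity)
      show "((\<lambda>t. \<beta> t * \<theta> n t) has_real_derivative \<beta>' t * \<theta> n t + \<theta>' n t * \<beta> t) (at t)" for t
        by (rule DERIV_mult[OF \<beta>_deriv \<theta>_deriv])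
      show "continuous_on UNIV (\<lambda>t. \<beta>' t * \<theta> n t + \<theta>' n t * \<beta> t)"
        by (intro continuous_intros continuous_\<beta>' continuous_\<beta> \<theta>_cont \<theta>'_cont)
      show "1 / N n > 0" using N by simp
      show "\<beta> t * \<theta> n t = 0 \<and> \<beta>' t * \<theta> n t + \<theta>' n t * \<beta> t = 0" if "t \<notin> {1 / N n..2 * R}" for t
      proof (cases "t < 1 / N n")
        case True
        then have "N n * t - 1 \<le> 0" using N[of n] by (simp add: field_simps)
        then show ?thesis by (simp add: \<theta>_def \<theta>'_def smoothstep_eq_0 smoothstep_deriv_eq_0)
      next
        case False
        then show ?thesis using that by (simp add: \<beta>_eq_0 \<beta>'_eq_0)
      qed
    qed
    finally show ?thesis .
  qed

  have lim_F: "(\<lambda>n. LINT X|lborel. F n X) \<longlonglongrightarrow>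
      (LINT X|lborel. indicator {0<..} (snd X) * (\<beta> (snd X) * bulk X + \<beta>' (snd X) * flux X))"
  proof (rule integral_tendsto_bounded_support[OF _ bounded_K F_supp F_bound])
    fix X :: "(real ^ 'd) \<times> real"
    have "(\<lambda>n. \<theta> n (snd X)) \<longlonglongrightarrow> indicator {0<..} (snd X)"
    proof (cases "snd X > 0")
      case True
      have "\<forall>\<^sub>F n in sequentially. \<theta> n (snd X) = indicator {0<..} (snd X)"
        using eventually_ge_at_top[of "nat \<lceil>2 / snd X\<rceil>"]
      proof eventually_elim
        case (elim n)
        then have "2 / snd X \<le> N n" unfolding N_def by linarith
        then have "N n * snd X - 1 \<ge> 1" using True by (simp add: field_simps)
        then show ?case using True by (simp add: \<theta>_def smoothstep_eq_1)
      qed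
      then show ?thesis by (rule tendsto_eventually)
    next
      case False
      then have "N n * snd X - 1 \<le> 0" for n
        using mult_nonneg_nonpos[of "N n" "snd X"] N[of n] by linarith
      then show ?thesis using False by (simp add: \<theta>_def smoothstep_eq_0)
    qed
    then show "(\<lambda>n. F n X) \<longlonglongrightarrow>
        indicator {0<..} (snd X) * (\<beta> (snd X) * bulk X + \<beta>' (snd X) * flux X)"
      unfolding F_def by (intro tendsto_intros)
  qed measurable

  have G_eq_H: "(LINT X|lborel. G n X) = (LINT X|lborel. H n X)" for n
  proof -
    have "(LINT X|lborel. G n X) = (LINT x|lborel. LINT t|lborel. G n (x, t))"
      by (rule lborel_integral_fst[symmetric], rule integrable_bounded_support[OF _ bounded_K])
         (use G_bound G_supp in measurable)
    also have "\<dots> = (LINT x|lborel. LINT s|lborel. H n (x, s))"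
    proof (rule Bochner_Integration.integral_cong[OF refl])
      fix x :: "real ^ 'd"
      have "(LINT t|lborel. G n (x, t)) = \<bar>1 / N n\<bar> *\<^sub>R (LINT s|lborel. G n (x, 1 / N n + 1 / N n * s))"
        by (rule lborel_integral_real_affine) (use N[of n] in auto)
      also have "\<dots> = (LINT s|lborel. \<bar>1 / N n\<bar> * G n (x, 1 / N n + 1 / N n * s))"
        by simp
      also have "\<dots> = (LINT s|lborel. H n (x, s))"
      proof (rule Bochner_Integration.integral_cong[OF refl])
        fix s :: real
        have "1 / N n + 1 / N n * s = (1 + s) / N n"
          by (simp add: add_divide_distrib)
        moreover have "N n * ((1 + s) / N n) - 1 = s"
          using N(2)[of n] by simp
        ultimately show "\<bar>1 / N n\<bar> * G n (x, 1 / N n + 1 / N n * s) = H n (x, s)"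
          using N[of n] by (simp add: G_def H_def \<theta>'_def)
      qed
      finally show "(LINT t|lborel. G n (x, t)) = (LINT s|lborel. H n (x, s))" .
    qed
    also have "\<dots> = (LINT X|lborel. H n X)"
      by (rule lborel_integral_fst, rule integrable_bounded_support[OF _ H_bounded_supp])
         (use H_bound H_supp in measurable)
    finally show ?thesis .
  qed

  have "(\<lambda>n. LINT X|lborel. H n X) \<longlonglongrightarrow>
      (LINT X|lborel. smoothstep_deriv (snd X) * flux (fst X, 0))"
  proof (rule integral_tendsto_bounded_support[OF _ H_bounded_supp H_supp H_bound])
    fix X :: "(real ^ 'd) \<times> real"
    show "(\<lambda>n. H n X) \<longlonglongrightarrow> smoothstep_deriv (snd X) * flux (fst X, 0)"
    proof (cases "X \<in> cball x\<^sub>0 (2 * R) \<times> {0..1}")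
      case False
      then have "smoothstep_deriv (snd X) * flux (fst X, 0) = 0"
        by (auto simp: mem_Times_iff smoothstep_deriv_eq_0 flux_def \<alpha>_eq_0 dist_commute)
      then show ?thesis using H_supp[OF False] by (simp only: tendsto_const)
    next
      case True
      have to_0: "(\<lambda>n. (1 + snd X) / N n) \<longlonglongrightarrow> 0"
        using LIMSEQ_Suc[OF lim_const_over_n[of "1 + snd X"]] by (simp add: N_def)
      have in_K': "(fst X, (1 + snd X) / N n) \<in> K'" for n
      proof -
        have "(1 + snd X) / N n \<le> 2 / 1"
          by (rule frac_le) (use True N[of n] in \<open>auto simp: mem_Times_iff\<close>)
        then show ?thesis
          using True N[of n] R_gt_1 by (auto simp: K'_def mem_Times_iff)
      qed
      have "(\<lambda>n. flux (fst X, (1 + snd X) / N n)) \<longlonglongrightarrow> flux (fst X, 0)"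
        by (rule continuous_on_tendsto_compose[OF continuous_flux])
           (use True in_K' R_gt_1 in \<open>auto intro!: tendsto_Pair to_0 simp: K'_def mem_Times_iff\<close>)
      moreover have "(\<lambda>n. \<beta> ((1 + snd X) / N n)) \<longlonglongrightarrow> \<beta> 0"
        by (rule continuous_on_tendsto_compose[OF continuous_\<beta>[of UNIV] to_0]) auto
      ultimately have "(\<lambda>n. H n X) \<longlonglongrightarrow> smoothstep_deriv (snd X) * (\<beta> 0 * flux (fst X, 0))"
        unfolding H_def by (intro tendsto_intros)
      then show ?thesis using R_pos by (simp add: \<beta>_eq_1)
    qed
  qed measurable
  moreover have "(LINT X|lborel. smoothstep_deriv (snd X) * flux (fst X, 0)) = (LINT x|lborel. flux (x, 0))"
  proof -
    have [measurable]: "(\<lambda>X::(real ^ 'd) \<times> real. (fst X, 0)) \<in> borel \<rightarrow>\<^sub>M (borel :: ((real ^ 'd) \<times> real) measure)"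
      by (intro borel_measurable_continuous_onI continuous_intros)
    have "(LINT X|lborel. smoothstep_deriv (snd X) * flux (fst X, 0))
        = (LINT x|lborel. LINT s|lborel. smoothstep_deriv s * flux (x, 0))"
    proof (subst lborel_integral_fst[symmetric])
      show "integrable lborel (\<lambda>X. smoothstep_deriv (snd X) * flux (fst X, 0))"
      proof (rule integrable_bounded_support[OF _ H_bounded_supp])
        show "(\<lambda>X::(real ^ 'd) \<times> real. smoothstep_deriv (snd X) * flux (fst X, 0))
            \<in> borel_measurable borel"
          by measurable
        show "\<bar>smoothstep_deriv (snd X) * flux (fst X, 0)\<bar> \<le> 2 * Mf" for X :: "(real ^ 'd) \<times> real"
          unfolding abs_mult
          by (intro mult_mono Mf) (use \<open>Mf \<ge> 0\<close> smoothstep_deriv_bounds in auto)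
      qed (auto simp: mem_Times_iff smoothstep_deriv_eq_0 flux_def \<alpha>_eq_0 dist_commute)
    qed simp
    then show ?thesis by (simp add: integral_smoothstep_deriv)
  qed
  ultimately have lim_G: "(\<lambda>n. LINT X|lborel. G n X) \<longlonglongrightarrow> (LINT x|lborel. flux (x, 0))"
    by (simp add: G_eq_H)
  have "(\<lambda>n. (LINT X|lborel. F n X) + (LINT X|lborel. G n X)) \<longlonglongrightarrow>
    (LINT X|lborel. indicator {0<..} (snd X) * (\<beta> (snd X) * bulk X + \<beta>' (snd X) * flux X))
    + (LINT x|lborel. flux (x, 0))"
    by (rule tendsto_add[OF lim_F lim_G])
  then show ?thesis
    unfolding sum_0 by (simp add: LIMSEQ_const_iff)
qed

section \<open>The Rellich estimate\<close>

subsection \<open>Energy and squared vertical difference\<close>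

definition energy :: "(real ^ 'd) \<times> real \<Rightarrow> real" where
  "energy X = form X (D X) (D X)"

lemma energy_bounds: "\<mu> * (norm (D X))\<^sup>2 \<le> energy X" "energy X \<le> (norm (D X))\<^sup>2 / \<mu>"
  unfolding energy_def by (rule coeff_form_elliptic[OF elliptic])+

lemma energy_nonneg: "0 \<le> energy X"
  using energy_bounds(1)[of X] \<mu>_pos by (meson mult_nonneg_nonneg order_trans less_imp_le zero_le_power2)

lemma energy_measurable [measurable]: "energy \<in> borel_measurable borel"
  unfolding energy_def[abs_def] by (rule form_measurable) measurable

lemma integrable_norm_D_power2: "integrable lborel (\<lambda>X. (norm (D X))\<^sup>2)"
proof -
  obtain M where M: "\<And>X. norm (D X) \<le> M" using D_bounded by blast
  show ?thesis
    by (rule integrable_bounded_support[OF _ bounded_K, where M = "M\<^sup>2"])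
       (auto simp: outside_K_eq_0 intro!: power_mono M)
qed

lemma integrable_energy: "integrable lborel energy"
proof (rule Bochner_Integration.integrable_bound)
  show "integrable lborel (\<lambda>X. (norm (D X))\<^sup>2 / \<mu>)"
    using integrable_norm_D_power2 by simp
  show "AE X in lborel. norm (energy X) \<le> norm ((norm (D X))\<^sup>2 / \<mu>)"
    using energy_bounds(2) energy_nonneg \<mu>_pos by auto
qed measurable

lemma integrable_q_power2: "integrable lborel (\<lambda>X. (q X)\<^sup>2)"
proof -
  obtain M where M: "\<And>X. \<bar>q X\<bar> \<le> M" using q_bounded by blast
  show ?thesis
  proof (rule integrable_bounded_support[OF _ compact_imp_bounded[OF compact_K'], where M = "M\<^sup>2"])
    show "\<bar>(q X)\<^sup>2\<bar> \<le> M\<^sup>2" for X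
      using M[of X] power_mono[OF M[of X], of 2] by simp
    show "(\<lambda>X. (q X)\<^sup>2) \<in> borel_measurable borel" by measurable
  qed (simp add: q_def)
qed

text \<open>
  The fundamental theorem of calculus on the segment from \<open>(x, t)\<close> to \<open>(x, t + 1)\<close>, followed by the
  Cauchy-Schwarz inequality. At \<open>t = 0\<close> the derivative exists only inside the segment, and continuity of
  \<open>u\<close> up to the boundary takes care of the end point. The half-open interval keeps the bottom itself
  out of the integral, in accordance with the slab \<open>0 < t \<le> 1\<close> that the telescoping leaves.
\<close>
lemma q_power2_le:
  assumes "dist x\<^sub>0 x < 3 * R"
  shows "(q (x, t))\<^sup>2 \<le> (LINT s|lborel. indicator {0<..1} s * (norm (D (x, t + s)))\<^sup>2)"
proof (cases "(x, t) \<in> K'")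
  case False
  then show ?thesis by (simp add: q_def Bochner_Integration.integral_nonneg)
next
  case True
  then have t: "0 \<le> t" "t \<le> 3 * R - 1" by (auto simp: K'_def)
  have in_K: "(x, t + s) \<in> K" if "s \<in> {0..1}" for s
    using that assms t by (auto simp: K_def)
  have cont_D: "continuous_on {0..1} (\<lambda>s. D (x, t + s))"
    by (intro continuous_on_compose2[OF continuous_D] continuous_intros) (use in_K in auto)
  have deriv: "((\<lambda>s. u (x, t + s)) has_vector_derivative (D (x, t + s) \<bullet> up)) (at s)"
    if "s \<in> {0<..<1}" for s
  proof -
    have "(x, t + s) \<in> T_cyl x\<^sub>0 (3 * R)"
      using that assms t by (auto simp: T_cyl_def)
    from GDERIV_u[OF this]
    have "(u has_derivative (\<lambda>h. h \<bullet> D (x, t + s))) (at (x, t + s))"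
      using in_K[of s] that by (simp add: gderiv_def D_def)
    moreover have "((\<lambda>s. (x, t + s)) has_derivative (\<lambda>h. h *\<^sub>R up)) (at s)"
      by (auto intro!: derivative_eq_intros)
    ultimately have "((\<lambda>s. u (x, t + s)) has_derivative (\<lambda>h. (h *\<^sub>R up) \<bullet> D (x, t + s))) (at s)"
      by (rule has_derivative_compose[rotated])
    then show ?thesis
      unfolding has_vector_derivative_def
      by (simp add: inner_commute del: scaleR_Pair)
  qed
  have "((\<lambda>s. D (x, t + s) \<bullet> up) has_integral (u (x, t + 1) - u (x, t + 0))) {0..1}"
    by (rule fundamental_theorem_of_calculus_interior[OF _ _ deriv])
       (use in_K in \<open>auto intro!: continuous_on_compose2[OF continuous_u] continuous_intros\<close>)
  then have "q (x, t) = integral {0..1} (\<lambda>s. D (x, t + s) \<bullet> up)"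
    using True by (simp add: q_def integral_unique)
  then have "(q (x, t))\<^sup>2 \<le> integral {0..1} (\<lambda>s. (D (x, t + s) \<bullet> up)\<^sup>2)"
    using power2_integral_unit_interval_le[of "\<lambda>s. D (x, t + s) \<bullet> up"] cont_D
    by (simp add: continuous_on_inner)
  also have "\<dots> \<le> integral {0..1} (\<lambda>s. (norm (D (x, t + s)))\<^sup>2)"
  proof (rule integral_le)
    show "(\<lambda>s. (D (x, t + s) \<bullet> up)\<^sup>2) integrable_on {0..1}"
      "(\<lambda>s. (norm (D (x, t + s)))\<^sup>2) integrable_on {0..1}"
      by (intro integrable_continuous_interval continuous_intros cont_D)+
    show "(D (x, t + s) \<bullet> up)\<^sup>2 \<le> (norm (D (x, t + s)))\<^sup>2" for s
      using power_mono[OF Cauchy_Schwarz_ineq2[of "D (x, t + s)" up], of 2] by simp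
  qed
  also have "\<dots> = (LINT s:{0..1}|lborel. (norm (D (x, t + s)))\<^sup>2)"
    by (rule set_borel_integral_eq_integral(2)[symmetric], rule borel_integrable_atLeastAtMost')
       (intro continuous_intros cont_D)
  also have "\<dots> = (LINT s|lborel. indicator {0<..1} s * (norm (D (x, t + s)))\<^sup>2)"
    unfolding set_lebesgue_integral_def
    by (subst integral_greaterThanAtMost_eq_atLeastAtMost) auto
  finally show ?thesis .
qed

text \<open>
  For \<open>t > 0\<close> the gradient of \<open>\<alpha> \<beta>\<close> vanishes off \<open>side\<close>.
\<close>
definition side :: "((real ^ 'd) \<times> real) set" where
  "side = ball x\<^sub>0 (2 * R) \<times> {0<..<2 * R} - T_cyl x\<^sub>0 R"

definition shell :: "((real ^ 'd) \<times> real) set" where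
  "shell = T_cyl x\<^sub>0 (3 * R) - T_cyl x\<^sub>0 R"

lemma sets_T_cyl [measurable]: "T_cyl x\<^sub>0 r \<in> sets borel"
  unfolding T_cyl_def by (intro borel_open open_Times open_ball open_greaterThanLessThan)

lemma sets_side [measurable]: "side \<in> sets borel"
proof -
  have "ball x\<^sub>0 (2 * R) \<times> {0<..<2 * R} \<in> sets borel"
    by (intro borel_open open_Times open_ball open_greaterThanLessThan)
  then show ?thesis unfolding side_def by (intro sets.Diff sets_T_cyl)
qed

lemma sets_shell [measurable]: "shell \<in> sets borel"
  unfolding shell_def by (intro sets.Diff sets_T_cyl)

text \<open>
  A point of \<open>side\<close> has radius at least \<open>R\<close>, which a vertical shift does not change, or height at least
  \<open>R\<close>, which an upward shift only increases.
\<close>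
lemma side_shift: "X \<in> side \<Longrightarrow> 0 \<le> s \<Longrightarrow> s \<le> 1 \<Longrightarrow> X + (0, s) \<in> shell"
  using R_gt_1 by (cases X) (auto simp: side_def shell_def T_cyl_def)

text \<open>
  Average over the shifts \<open>s\<close> in \<open>(0, 1]\<close>: for each of them the translate of \<open>side\<close> is contained in
  \<open>shell\<close>.
\<close>
lemma integral_q_power2_side_le:
  "(LINT X|lborel. indicator side X * (q X)\<^sup>2) \<le> (LINT X|lborel. indicator shell X * (norm (D X))\<^sup>2)"
proof -
  define f where "f Y = indicator side (fst Y) * (indicator {0<..1} (snd Y) *
      (norm (D (fst Y + (0, snd Y))))\<^sup>2)" for Y :: "((real ^ 'd) \<times> real) \<times> real"
  obtain M where M: "\<And>X. norm (D X) \<le> M" using D_bounded by blast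
  have "bounded side"
    by (rule bounded_subset[of "ball x\<^sub>0 (2 * R) \<times> {0<..<2 * R}"])
       (auto simp: side_def intro!: bounded_Times bounded_subset[OF bounded_closed_interval[of 0 "2 * R"]])
  have [measurable]: "(fst :: ((real ^ 'd) \<times> real) \<times> real \<Rightarrow> _) \<in> borel \<rightarrow>\<^sub>M borel"
    "(snd :: ((real ^ 'd) \<times> real) \<times> real \<Rightarrow> _) \<in> borel \<rightarrow>\<^sub>M borel"
    "(\<lambda>Y::((real ^ 'd) \<times> real) \<times> real. fst Y + (0, snd Y)) \<in> borel \<rightarrow>\<^sub>M borel"
    by (intro borel_measurable_continuous_onI continuous_intros)+
  have f_int: "integrable lborel f"
  proof (rule integrable_bounded_support)
    show "bounded (side \<times> {0..1::real})"
      by (intro bounded_Times \<open>bounded side\<close> bounded_closed_interval)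
    show "f \<in> borel_measurable borel" unfolding f_def[abs_def] by measurable
    show "f Y = 0" if "Y \<notin> side \<times> {0..1}" for Y
      using that by (auto simp: f_def indicator_def mem_Times_iff)
    show "\<bar>f Y\<bar> \<le> M\<^sup>2" for Y
      using power_mono[OF M[of "fst Y + (0, snd Y)"], of 2] by (auto simp: f_def indicator_def)
  qed
  have int_shell: "integrable lborel (\<lambda>X. indicator shell X * (norm (D X))\<^sup>2)"
    by (rule integrable_mult_abs_le_1[OF integrable_norm_D_power2]) (auto simp: indicator_def)
  have "(LINT X|lborel. indicator side X * (q X)\<^sup>2) \<le> (LINT X|lborel. LINT s|lborel. f (X, s))"
  proof (rule integral_mono)
    show "integrable lborel (\<lambda>X. indicator side X * (q X)\<^sup>2)"
      by (rule integrable_mult_abs_le_1[OF integrable_q_power2]) (auto simp: indicator_def)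
    show "integrable lborel (\<lambda>X. LINT s|lborel. f (X, s))"
      using lborel_pair.integrable_fst'[of f] f_int by (simp add: lborel_prod)
    show "indicator side X * (q X)\<^sup>2 \<le> (LINT s|lborel. f (X, s))" for X
    proof (cases "X \<in> side")
      case True
      then have "dist x\<^sub>0 (fst X) < 3 * R" using R_gt_1 by (auto simp: side_def)
      then show ?thesis
        using q_power2_le[of "fst X" "snd X"] True by (cases X) (simp add: f_def)
    qed (simp add: f_def)
  qed
  also have "\<dots> = (LINT s|lborel. LINT X|lborel. f (X, s))"
    by (simp add: lborel_integral_fst[OF f_int] lborel_integral_snd[OF f_int])
  also have "\<dots> \<le> (LINT s|lborel. indicator {0..1::real} s * (LINT X|lborel. indicator shell X * (norm (D X))\<^sup>2))"
  proof (rule integral_mono)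
    show "integrable lborel (\<lambda>s. LINT X|lborel. f (X, s))"
      using lborel_pair.integrable_snd[of "\<lambda>X s. f (X, s)"] f_int by (simp add: lborel_prod)
    show "integrable lborel (\<lambda>s. indicator {0..1::real} s * (LINT X|lborel. indicator shell X * (norm (D X))\<^sup>2))"
      by (intro integrable_mult_left integrable_real_indicator) auto
    show "(LINT X|lborel. f (X, s)) \<le> indicator {0..1} s * (LINT X|lborel. indicator shell X * (norm (D X))\<^sup>2)" for s
    proof (cases "s \<in> {0<..1}")
      case True
      have "(LINT X|lborel. f (X, s)) \<le> (LINT X|lborel. indicator shell (X + (0, s)) * (norm (D (X + (0, s))))\<^sup>2)"
      proof (rule integral_mono')
        show "integrable lborel (\<lambda>X. indicator shell (X + (0, s)) * (norm (D (X + (0, s))))\<^sup>2)"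
          by (rule integrable_translation_lborel[OF int_shell])
        show "f (X, s) \<le> indicator shell (X + (0, s)) * (norm (D (X + (0, s))))\<^sup>2" for X
          using True side_shift[of X s] by (auto simp: f_def indicator_def)
      qed auto
      also have "\<dots> = (LINT X|lborel. indicator shell X * (norm (D X))\<^sup>2)"
        by (rule integral_translation_lborel[where f = "\<lambda>X. indicator shell X * (norm (D X))\<^sup>2"]) measurable
      finally show ?thesis using True by simp
    next
      case False
      then have "(LINT X|lborel. f (X, s)) = 0" by (simp add: f_def)
      then show ?thesis by (simp add: Bochner_Integration.integral_nonneg)
    qed
  qed
  also have "\<dots> = (LINT X|lborel. indicator shell X * (norm (D X))\<^sup>2)"
    by simp
  finally show ?thesis .
qed

text \<open>
  Here the weight \<open>\<alpha>\<close> does not depend on \<open>t\<close>, so that the right-hand side is exactly the weighted slab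
  energy and can be absorbed.
\<close>
lemma integral_q_power2_bottom_le:
  "(LINT x|lborel. \<alpha> x * (q (x, 0))\<^sup>2)
    \<le> (LINT X|lborel. indicator {0<..1} (snd X) * \<alpha> (fst X) * (norm (D X))\<^sup>2)"
proof -
  define f where "f X = indicator {0<..1} (snd X) * \<alpha> (fst X) * (norm (D X))\<^sup>2" for X
  have f_int: "integrable lborel f"
    unfolding f_def[abs_def]
    by (rule integrable_mult_abs_le_1[OF integrable_norm_D_power2])
       (use \<alpha>_bounds in \<open>auto simp: indicator_def\<close>)
  have "(LINT x|lborel. \<alpha> x * (q (x, 0))\<^sup>2) \<le> (LINT x|lborel. LINT s|lborel. f (x, s))"
  proof (rule integral_mono')
    show "integrable lborel (\<lambda>x. LINT s|lborel. f (x, s))"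
      using lborel_pair.integrable_fst'[of f] f_int by (simp add: lborel_prod)
    show "0 \<le> (LINT s|lborel. f (x, s))" for x
      by (rule Bochner_Integration.integral_nonneg) (simp add: f_def \<alpha>_bounds)
    show "\<alpha> x * (q (x, 0))\<^sup>2 \<le> (LINT s|lborel. f (x, s))" for x
    proof (cases "dist x\<^sub>0 x < 3 * R")
      case True
      have "\<alpha> x * (q (x, 0))\<^sup>2 \<le> \<alpha> x * (LINT s|lborel. indicator {0<..1} s * (norm (D (x, 0 + s)))\<^sup>2)"
        by (intro mult_left_mono q_power2_le True \<alpha>_bounds)
      also have "\<dots> = (LINT s|lborel. f (x, s))"
        by (subst integral_mult_right_zero[symmetric]) (simp add: f_def mult_ac)
      finally show ?thesis .
    next
      case False
      then have "\<alpha> x = 0" using R_pos by (intro \<alpha>_eq_0) (simp add: dist_commute)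
      then show ?thesis by (simp add: f_def)
    qed
  qed
  then show ?thesis
    unfolding lborel_integral_fst[OF f_int] by (simp add: f_def[abs_def])
qed

subsection \<open>The Rellich identity and its error terms\<close>

text \<open>
  Polarisation: for a symmetric form, \<open>2 B(\<xi>, \<eta> - \<xi>) = B(\<eta>, \<eta>) - B(\<xi>, \<xi>) - B(\<eta> - \<xi>, \<eta> - \<xi>)\<close>, with
  \<open>\<xi>\<close> and \<open>\<eta>\<close> the gradients of \<open>u\<close> at \<open>X\<close> and \<open>X + up\<close>.
\<close>
lemma rellich_identity:
  "\<beta> t * bulk (x, t) + \<beta>' t * flux (x, t) =
     \<alpha> x * \<beta> t / 2 * (energy ((x, t) + up) - energy (x, t)
       - form (x, t) (D ((x, t) + up) - D (x, t)) (D ((x, t) + up) - D (x, t)))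
     + q (x, t) * form (x, t) (D (x, t)) (\<beta> t *\<^sub>R D\<alpha> x, \<alpha> x * \<beta>' t)"
proof -
  let ?X = "(x, t)"
  define \<xi> \<eta> where "\<xi> = D ?X" and "\<eta> = D (?X + up)"
  have split: "(\<beta> t *\<^sub>R D\<alpha> x, \<alpha> x * \<beta>' t) = \<beta> t *\<^sub>R (D\<alpha> x, 0) + (\<alpha> x * \<beta>' t) *\<^sub>R up"
    by simp
  have "energy (?X + up) = form ?X \<eta> \<eta>" "energy ?X = form ?X \<xi> \<xi>"
    by (simp_all only: energy_def form_shift \<xi>_def \<eta>_def)
  moreover have "2 * form ?X \<xi> (\<eta> - \<xi>) = form ?X \<eta> \<eta> - form ?X \<xi> \<xi> - form ?X (\<eta> - \<xi>) (\<eta> - \<xi>)"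
    using coeff_form_commute[OF symmetric, of ?X \<xi> \<eta>] by (simp add: coeff_form_bilinear)
  ultimately have "energy (?X + up) - energy ?X - form ?X (\<eta> - \<xi>) (\<eta> - \<xi>) = 2 * form ?X \<xi> (\<eta> - \<xi>)"
    by simp
  then show ?thesis
    unfolding split \<xi>_def[symmetric] \<eta>_def[symmetric]
    by (simp add: bulk_def flux_def coeff_form_bilinear(2,6) \<xi>_def[symmetric] \<eta>_def[symmetric]
        del: scaleR_Pair add_Pair)
       (simp add: algebra_simps)
qed

text \<open>
  Rescale by \<open>R\<close>: the vector \<open>R \<nabla>(\<alpha> \<beta>)\<close> has squared length at most \<open>(8/3)\<^sup>2 + 2\<^sup>2 \<le> 12\<close>, and the
  remaining factor \<open>1/R\<close> is the gain.
\<close>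
lemma cutoff_error_le:
  assumes "t > 0"
  shows "q (x, t) * form (x, t) (D (x, t)) (\<beta> t *\<^sub>R D\<alpha> x, \<alpha> x * \<beta>' t)
    \<le> 1 / (2 * \<mu> * R) * (indicator side (x, t) * ((norm (D (x, t)))\<^sup>2 + 12 * (q (x, t))\<^sup>2))"
proof (cases "(x, t) \<in> side")
  case False
  with assms have "D\<alpha> x = 0 \<and> \<beta>' t = 0 \<or> \<alpha> x = 0 \<and> D\<alpha> x = 0 \<or> \<beta> t = 0 \<and> \<beta>' t = 0"
    by (auto simp: side_def T_cyl_def not_less dist_commute D\<alpha>_eq_0 \<alpha>_eq_0 \<beta>_eq_0 \<beta>'_eq_0)
  then have "(\<beta> t *\<^sub>R D\<alpha> x, \<alpha> x * \<beta>' t) = 0" by (auto simp: zero_prod_def)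
  then show ?thesis using False by (simp add: coeff_form_bilinear)
next
  case True
  define \<eta> where "\<eta> = (\<beta> t *\<^sub>R D\<alpha> x, \<alpha> x * \<beta>' t)"
  have "norm (\<beta> t *\<^sub>R D\<alpha> x) \<le> 1 * (8 / (3 * R))"
    unfolding norm_scaleR by (intro mult_mono norm_D\<alpha>_le) (use \<beta>_bounds in auto)
  then have "(norm (\<beta> t *\<^sub>R D\<alpha> x))\<^sup>2 \<le> (8 / (3 * R))\<^sup>2" by (intro power_mono) auto
  moreover have "\<bar>\<alpha> x * \<beta>' t\<bar> \<le> 1 * (2 / R)"
    unfolding abs_mult by (intro mult_mono abs_\<beta>'_le) (use \<alpha>_bounds in auto)
  then have "(\<alpha> x * \<beta>' t)\<^sup>2 \<le> (2 / R)\<^sup>2"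
    by (intro abs_le_square_iff[THEN iffD1]) (use R_pos in simp)
  moreover have "(norm \<eta>)\<^sup>2 = (norm (\<beta> t *\<^sub>R D\<alpha> x))\<^sup>2 + (\<alpha> x * \<beta>' t)\<^sup>2"
    by (simp add: \<eta>_def norm_Pair)
  ultimately have "(norm \<eta>)\<^sup>2 \<le> (8 / (3 * R))\<^sup>2 + (2 / R)\<^sup>2" by simp
  also have "\<dots> \<le> 12 / R\<^sup>2"
    using R_pos by (simp add: power_divide power_mult_distrib field_simps)
  finally have "R\<^sup>2 * (norm \<eta>)\<^sup>2 \<le> 12" using R_pos by (simp add: field_simps)
  then have "(norm ((R * q (x, t)) *\<^sub>R \<eta>))\<^sup>2 \<le> 12 * (q (x, t))\<^sup>2"
    using mult_right_mono[of "R\<^sup>2 * (norm \<eta>)\<^sup>2" 12 "(q (x, t))\<^sup>2"]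
    by (simp add: power_mult_distrib mult_ac)
  then have "((norm (D (x, t)))\<^sup>2 + (norm ((R * q (x, t)) *\<^sub>R \<eta>))\<^sup>2) / (2 * \<mu>)
      \<le> ((norm (D (x, t)))\<^sup>2 + 12 * (q (x, t))\<^sup>2) / (2 * \<mu>)"
    using \<mu>_pos by (intro divide_right_mono) auto
  with abs_coeff_form_le[OF symmetric elliptic \<mu>_pos, of "(x, t)" "D (x, t)" "(R * q (x, t)) *\<^sub>R \<eta>"]
  have "form (x, t) (D (x, t)) ((R * q (x, t)) *\<^sub>R \<eta>)
      \<le> ((norm (D (x, t)))\<^sup>2 + 12 * (q (x, t))\<^sup>2) / (2 * \<mu>)" by linarith
  then have "R * (q (x, t) * form (x, t) (D (x, t)) \<eta>)
      \<le> ((norm (D (x, t)))\<^sup>2 + 12 * (q (x, t))\<^sup>2) / (2 * \<mu>)"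
    by (simp only: coeff_form_bilinear mult.assoc)
  then have "q (x, t) * form (x, t) (D (x, t)) \<eta>
      \<le> ((norm (D (x, t)))\<^sup>2 + 12 * (q (x, t))\<^sup>2) / (2 * \<mu>) / R"
    by (intro pos_le_divide_eq[THEN iffD2, OF R_pos]) (simp add: mult_ac)
  then show ?thesis using True by (simp add: \<eta>_def)
qed

text \<open>
  Young's inequality with the weight \<open>\<mu>/4\<close>, half of the \<open>\<mu>/2\<close> that ellipticity puts in front of the slab
  energy. The sign of \<open>flux\<close> comes from \<open>up\<close> being the inward normal at the bottom.
\<close>
lemma flux_bottom_le:
  "flux (x, 0) \<le> \<mu> / 4 * (\<alpha> x * (q (x, 0))\<^sup>2) + 1 / \<mu> * (indicator (ball x\<^sub>0 (2 * R)) x * (g x)\<^sup>2)"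
proof (cases "dist x\<^sub>0 x < 2 * R")
  case False
  then have "\<alpha> x = 0" by (intro \<alpha>_eq_0) (simp add: dist_commute)
  then show ?thesis using False by (simp add: flux_def)
next
  case True
  then have "dist x\<^sub>0 x < 3 * R" using R_pos by simp
  then have "D (x, 0) = Du (x, 0)" "form (x, 0) (Du (x, 0)) (0, -1) = g x"
    using neumann[of x] R_pos by (auto simp: D_def K_def conormal_deriv_def coeff_form_def)
  moreover have "up = (-1) *\<^sub>R (0, -1)" by simp
  ultimately have "form (x, 0) (D (x, 0)) up = - g x"
    by (simp only: coeff_form_bilinear)
  then have "flux (x, 0) = \<alpha> x * (- (q (x, 0) * g x))"
    by (simp add: flux_def)
  also have "\<dots> \<le> \<alpha> x * (\<mu> / 4 * (q (x, 0))\<^sup>2 + 1 / \<mu> * (g x)\<^sup>2)"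
  proof (rule mult_left_mono)
    have "0 \<le> (\<mu> * q (x, 0) / 2 + g x)\<^sup>2 / \<mu>" using \<mu>_pos by simp
    also have "\<dots> = \<mu> / 4 * (q (x, 0))\<^sup>2 + 1 / \<mu> * (g x)\<^sup>2 + q (x, 0) * g x"
      using \<mu>_pos by (simp add: power2_eq_square field_simps)
    finally show "- (q (x, 0) * g x) \<le> \<mu> / 4 * (q (x, 0))\<^sup>2 + 1 / \<mu> * (g x)\<^sup>2" by simp
  qed (rule \<alpha>_bounds)
  also have "\<dots> \<le> \<mu> / 4 * (\<alpha> x * (q (x, 0))\<^sup>2) + 1 / \<mu> * (g x)\<^sup>2"
    using mult_right_mono[OF \<alpha>_bounds(2)[of x], of "1 / \<mu> * (g x)\<^sup>2"] \<mu>_pos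
    by (simp add: algebra_simps)
  finally show ?thesis using True by simp
qed

text \<open>
  The left-hand side is \<open>\<alpha> E\<close> times the shifted minus the original weight in \<open>t\<close>. These weights cancel
  where both are one or both are zero; on the slab \<open>0 < t \<le> 1\<close> only the original weight, equal to one,
  is present; at the heights between \<open>R\<close> and \<open>2R + 1\<close> the difference is at most \<open>2/R\<close>.
\<close>
lemma telescoped_energy_le:
  "indicator {1<..} t * \<alpha> x * \<beta> (t - 1) * energy (x, t) - indicator {0<..} t * \<alpha> x * \<beta> t * energy (x, t)
    \<le> 2 / (\<mu> * R) * (indicator shell (x, t) * (norm (D (x, t)))\<^sup>2)
      - \<mu> * (indicator {0<..1} t * \<alpha> x * (norm (D (x, t)))\<^sup>2)"
proof -
  let ?X = "(x, t)"
  consider "t \<le> 0" | "0 < t" "t \<le> 1" | "1 < t" "t \<le> R \<or> 2 * R + 1 \<le> t \<or> 2 * R \<le> dist x\<^sub>0 x"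
    | "R < t" "t < 2 * R + 1" "dist x\<^sub>0 x < 2 * R" by linarith
  then show ?thesis
  proof cases
    case 1
    then show ?thesis using \<mu>_pos R_pos by (simp add: indicator_def)
  next
    case 2
    then have "\<mu> * (\<alpha> x * (norm (D ?X))\<^sup>2) \<le> \<alpha> x * energy ?X"
      using mult_left_mono[OF energy_bounds(1)[of ?X] \<alpha>_bounds(1)[of x]] by (simp add: mult_ac)
    moreover have "\<beta> t = 1" using 2 R_gt_1 by (intro \<beta>_eq_1) simp
    moreover have "0 \<le> 2 / (\<mu> * R) * (indicator shell ?X * (norm (D ?X))\<^sup>2)"
      using \<mu>_pos R_pos by simp
    ultimately show ?thesis using 2 by simp
  next
    case 3
    then have "\<alpha> x = 0 \<or> \<beta> (t - 1) = \<beta> t"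
      by (auto simp: \<alpha>_eq_0 \<beta>_eq_1 \<beta>_eq_0 dist_commute)
    moreover have "0 \<le> 2 / (\<mu> * R) * (indicator shell ?X * (norm (D ?X))\<^sup>2)"
      using \<mu>_pos R_pos by simp
    ultimately show ?thesis using 3 by auto
  next
    case 4
    then have "t > 1" "?X \<in> shell" using R_gt_1 by (auto simp: shell_def T_cyl_def)
    have "\<alpha> x * (\<beta> (t - 1) - \<beta> t) \<le> 1 * (2 / R)"
      using mult_left_mono[OF \<beta>_shift_le[of t] \<alpha>_bounds(1)[of x]] R_pos
        mult_right_mono[OF \<alpha>_bounds(2)[of x], of "2 / R"] by simp
    then have "\<alpha> x * (\<beta> (t - 1) - \<beta> t) * energy ?X \<le> 2 / R * ((norm (D ?X))\<^sup>2 / \<mu>)"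
      using mult_right_mono[OF _ energy_nonneg, of _ "2 / R" ?X]
        mult_left_mono[OF energy_bounds(2)[of ?X], of "2 / R"] R_pos by force
    then show ?thesis
      using \<open>t > 1\<close> \<open>?X \<in> shell\<close> by (simp add: algebra_simps)
  qed
qed

subsection \<open>Absorption of the boundary term\<close>

text \<open>
  Integrate the Rellich identity and insert the bounds on its terms. With \<open>l\<close>, \<open>w\<close> and \<open>\<gamma>\<close> for the
  integrands of the slab energy, of the energy in \<open>shell\<close> and of \<open>g\<^sup>2\<close>, this leads to
  \<open>\<mu>/2 \<integral>l \<le> \<mu>/4 \<integral>l + 1/\<mu> \<integral>\<gamma> + (1 + 13/2)/(\<mu> R) \<integral>w\<close>, where \<open>1\<close> is the share of the telescoping and
  \<open>13/2\<close> that of the cutoff error. Absorption leaves \<open>\<mu>/4 \<integral>l\<close> on the left, whence the constants.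
\<close>
lemma weighted_slab_estimate:
  "(LINT X|lborel. indicator {0<..1} (snd X) * \<alpha> (fst X) * (norm (D X))\<^sup>2)
    \<le> 4 / \<mu>\<^sup>2 * (LINT x|lborel. indicator (ball x\<^sub>0 (2 * R)) x * (g x)\<^sup>2)
      + 30 / \<mu>\<^sup>2 / R * (LINT X|lborel. indicator shell X * (norm (D X))\<^sup>2)"
proof -
  define l where "l X = indicator {0<..1} (snd X) * \<alpha> (fst X) * (norm (D X))\<^sup>2" for X
  define w where "w X = indicator shell X * (norm (D X))\<^sup>2" for X
  define \<sigma> where "\<sigma> X = indicator side X * (norm (D X))\<^sup>2" for X
  define \<tau> where "\<tau> X = indicator side X * (q X)\<^sup>2" for X
  define \<gamma> where "\<gamma> x = indicator (ball x\<^sub>0 (2 * R)) x * (g x)\<^sup>2" for x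
  define b where "b x = \<alpha> x * (q (x, 0))\<^sup>2" for x
  define E1 where "E1 X = indicator {1<..} (snd X) * \<alpha> (fst X) * \<beta> (snd X - 1) * energy X" for X
  define E0 where "E0 X = indicator {0<..} (snd X) * \<alpha> (fst X) * \<beta> (snd X) * energy X" for X
  define bdry where "bdry x = flux (x, 0)" for x
  define inner_part where "inner_part X = indicator {0<..} (snd X) *
      (\<beta> (snd X) * bulk X + \<beta>' (snd X) * flux X)" for X

  have [simp]: "\<bar>\<alpha> x * \<beta> t\<bar> \<le> 1" for x t
    using \<alpha>_bounds[of x] \<beta>_bounds[of t] by (simp add: abs_mult mult_le_one)
  have [measurable]: "(\<lambda>x::real ^ 'd. (x, 0::real)) \<in> borel \<rightarrow>\<^sub>M borel"
    by (intro borel_measurable_continuous_onI continuous_intros)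
  have int_l: "integrable lborel l"
    unfolding l_def[abs_def]
    by (rule integrable_mult_abs_le_1[OF integrable_norm_D_power2])
       (use \<alpha>_bounds in \<open>auto simp: indicator_def\<close>)
  have int_w: "integrable lborel w" and int_\<sigma>: "integrable lborel \<sigma>" and int_\<tau>: "integrable lborel \<tau>"
    unfolding w_def[abs_def] \<sigma>_def[abs_def] \<tau>_def[abs_def]
    by (rule integrable_mult_abs_le_1[OF integrable_norm_D_power2]
        integrable_mult_abs_le_1[OF integrable_q_power2]; auto simp: indicator_def)+
  have int_E: "integrable lborel E1" "integrable lborel E0"
    unfolding E1_def[abs_def] E0_def[abs_def]
    by (rule integrable_mult_abs_le_1[OF integrable_energy]; auto simp: indicator_def mult.assoc)+
  have int_inner: "integrable lborel inner_part"
  proof -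
    obtain Mb where Mb: "\<And>X. \<bar>bulk X\<bar> \<le> Mb" using bulk_bounded by blast
    obtain Mf where Mf: "\<And>X. \<bar>flux X\<bar> \<le> Mf" using flux_bounded by blast
    have int_bf: "integrable lborel bulk" "integrable lborel flux"
      by (rule integrable_bounded_support[OF _ bounded_K]; use Mb Mf outside_K_eq_0 in measurable)+
    have "integrable lborel (\<lambda>X. (indicator {0<..} (snd X) * \<beta> (snd X)) * bulk X
        + 2 / R * ((indicator {0<..} (snd X) * (\<beta>' (snd X) * (R / 2))) * flux X))"
    proof (intro Bochner_Integration.integrable_add integrable_mult_right
        integrable_mult_abs_le_1[OF int_bf(1)] integrable_mult_abs_le_1[OF int_bf(2)])
      show "\<bar>indicator {0<..} (snd X) * \<beta> (snd X)\<bar> \<le> 1" for X :: "(real ^ 'd) \<times> real"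
        using \<beta>_bounds by (simp add: indicator_def)
      show "\<bar>indicator {0<..} (snd X) * (\<beta>' (snd X) * (R / 2))\<bar> \<le> 1" for X :: "(real ^ 'd) \<times> real"
        using mult_right_mono[OF abs_\<beta>'_le[of "snd X"], of "R / 2"] R_pos
        by (simp add: indicator_def abs_mult)
    qed measurable
    then show ?thesis
      unfolding inner_part_def[abs_def] using R_pos by (simp add: algebra_simps)
  qed
  have flux_0: "flux (x, 0) = 0" if "x \<notin> cball x\<^sub>0 (2 * R)" for x
    using that by (simp add: flux_def \<alpha>_eq_0 dist_commute)
  have int_bdry: "integrable lborel bdry"
  proof -
    obtain Mf where "\<And>X. \<bar>flux X\<bar> \<le> Mf" using flux_bounded by blast
    then show ?thesis
      unfolding bdry_def[abs_def]
      by (intro integrable_bounded_support[OF _ bounded_cball flux_0]) measurable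
  qed
  have int_b: "integrable lborel b"
  proof -
    obtain M where M: "\<And>X. \<bar>q X\<bar> \<le> M" using q_bounded by blast
    show ?thesis
    proof (rule integrable_bounded_support[OF _ bounded_cball])
      show "b \<in> borel_measurable borel" unfolding b_def[abs_def] by measurable
      show "b x = 0" if "x \<notin> cball x\<^sub>0 (2 * R)" for x
        using that by (simp add: b_def \<alpha>_eq_0 dist_commute)
      show "\<bar>b x\<bar> \<le> 1 * M\<^sup>2" for x
        unfolding b_def abs_mult
        by (rule mult_mono) (use \<alpha>_bounds power_mono[OF M[of "(x, 0)"], of 2] in auto)
    qed
  qed
  have int_\<gamma>: "integrable lborel \<gamma>"
  proof -
    obtain M where M: "\<And>X. norm (D X) \<le> M" using D_bounded by blast
    have *: "\<gamma> x = indicator (ball x\<^sub>0 (2 * R)) x * (form (x, 0) (D (x, 0)) (0, -1))\<^sup>2" for x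
    proof (cases "x \<in> ball x\<^sub>0 (2 * R)")
      case True
      then have "D (x, 0) = Du (x, 0)" "form (x, 0) (Du (x, 0)) (0, -1) = g x"
        using neumann[of x] R_pos by (auto simp: D_def K_def conormal_deriv_def coeff_form_def)
      then show ?thesis by (simp add: \<gamma>_def)
    qed (simp add: \<gamma>_def)
    have [measurable]: "(\<lambda>X. form X (D X) (0, -1)) \<in> borel_measurable borel"
      by (rule form_measurable) measurable
    have form_bottom: "(\<lambda>x. form (x, 0) (D (x, 0)) (0, -1)) \<in> borel_measurable borel"
      using measurable_compose[of "\<lambda>x. (x, 0)" borel borel "\<lambda>X. form X (D X) (0, -1)" borel] by simp
    show ?thesis
    proof (rule integrable_bounded_support[OF _ bounded_ball[of x\<^sub>0 "2 * R"]])
      show "\<gamma> \<in> borel_measurable borel"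
        unfolding *[abs_def]
        by (intro borel_measurable_times borel_measurable_indicator borel_measurable_power form_bottom)
           simp
      show "\<bar>\<gamma> x\<bar> \<le> ((M\<^sup>2 + 1\<^sup>2) / (2 * \<mu>))\<^sup>2" for x
        using power_mono[OF form_bounded[OF M, of "(0, -1)" 1 "(x, 0)" "(x, 0)"], of 2]
        by (simp add: * indicator_def)
    qed (simp add: \<gamma>_def)
  qed

  \<comment> \<open>The form at the gradient of \<open>q\<close> is dropped here: it is nonnegative and enters with a minus sign.\<close>
  have pointwise: "inner_part X \<le> 1 / 2 * E1 (X + up) - 1 / 2 * E0 X
      + 1 / (2 * \<mu> * R) * (\<sigma> X + 12 * \<tau> X)" for X
  proof (cases "snd X > 0")
    case False
    then show ?thesis
      using \<mu>_pos R_pos by (simp add: inner_part_def E1_def E0_def \<sigma>_def \<tau>_def)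
  next
    case True
    obtain x t where X: "X = (x, t)" by (cases X)
    with True have "t > 0" by simp
    have nonneg: "0 \<le> form X Y Y" for Y
      using coeff_form_elliptic(1)[OF elliptic, of Y X] \<mu>_pos
      by (meson mult_nonneg_nonneg order_trans less_imp_le zero_le_power2)
    have "inner_part X = \<beta> t * bulk X + \<beta>' t * flux X"
      using True X by (simp add: inner_part_def)
    also have "\<dots> \<le> \<alpha> x * \<beta> t / 2 * (energy (X + up) - energy X)
        + 1 / (2 * \<mu> * R) * (indicator side X * ((norm (D X))\<^sup>2 + 12 * (q X)\<^sup>2))"
      unfolding X rellich_identity
      by (intro add_mono cutoff_error_le[OF \<open>t > 0\<close>] mult_left_mono)
         (use nonneg \<alpha>_bounds \<beta>_bounds X in auto)
    also have "\<dots> = 1 / 2 * E1 (X + up) - 1 / 2 * E0 X + 1 / (2 * \<mu> * R) * (\<sigma> X + 12 * \<tau> X)"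
      using \<open>t > 0\<close> by (simp add: E1_def E0_def \<sigma>_def \<tau>_def X algebra_simps)
    finally show ?thesis .
  qed

  have "0 = (LINT X|lborel. inner_part X) + (LINT x|lborel. bdry x)"
    using green_identity by (simp add: inner_part_def bdry_def)
  also have "\<dots> \<le> (LINT X|lborel. 1 / 2 * E1 (X + up) - 1 / 2 * E0 X + 1 / (2 * \<mu> * R) * (\<sigma> X + 12 * \<tau> X))
      + (LINT x|lborel. \<mu> / 4 * b x + 1 / \<mu> * \<gamma> x)"
  proof (rule add_mono)
    show "(LINT X|lborel. inner_part X)
      \<le> (LINT X|lborel. 1 / 2 * E1 (X + up) - 1 / 2 * E0 X + 1 / (2 * \<mu> * R) * (\<sigma> X + 12 * \<tau> X))"
      by (rule integral_mono[OF int_inner _ pointwise])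
         (intro Bochner_Integration.integrable_add Bochner_Integration.integrable_diff
            integrable_mult_right int_E int_\<sigma> int_\<tau> integrable_translation_lborel)
    show "(LINT x|lborel. bdry x) \<le> (LINT x|lborel. \<mu> / 4 * b x + 1 / \<mu> * \<gamma> x)"
    proof (rule integral_mono[OF int_bdry])
      show "integrable lborel (\<lambda>x. \<mu> / 4 * b x + 1 / \<mu> * \<gamma> x)"
        by (intro Bochner_Integration.integrable_add integrable_mult_right int_b int_\<gamma>)
      show "bdry x \<le> \<mu> / 4 * b x + 1 / \<mu> * \<gamma> x" for x
        using flux_bottom_le by (simp add: bdry_def b_def \<gamma>_def)
    qed
  qed
  also have "\<dots> = 1 / 2 * ((LINT X|lborel. E1 X) - (LINT X|lborel. E0 X))
      + 1 / (2 * \<mu> * R) * ((LINT X|lborel. \<sigma> X) + 12 * (LINT X|lborel. \<tau> X))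
      + (\<mu> / 4 * (LINT x|lborel. b x) + 1 / \<mu> * (LINT x|lborel. \<gamma> x))"
    using int_E int_\<sigma> int_\<tau> int_b int_\<gamma> integrable_translation_lborel[OF int_E(1), of up]
      integral_translation_lborel[OF borel_measurable_integrable[OF int_E(1), simplified], of up]
    by (simp add: algebra_simps)
  finally have total: "0 \<le> 1 / 2 * ((LINT X|lborel. E1 X) - (LINT X|lborel. E0 X))
      + 1 / (2 * \<mu> * R) * ((LINT X|lborel. \<sigma> X) + 12 * (LINT X|lborel. \<tau> X))
      + (\<mu> / 4 * (LINT x|lborel. b x) + 1 / \<mu> * (LINT x|lborel. \<gamma> x))" .

  have "(LINT X|lborel. E1 X) - (LINT X|lborel. E0 X) = (LINT X|lborel. E1 X - E0 X)"
    using int_E by simp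
  also have "\<dots> \<le> (LINT X|lborel. 2 / (\<mu> * R) * w X - \<mu> * l X)"
  proof (rule integral_mono)
    show "E1 X - E0 X \<le> 2 / (\<mu> * R) * w X - \<mu> * l X" for X
      using telescoped_energy_le[of "snd X" "fst X"] by (simp add: E1_def E0_def w_def l_def)
  qed (use int_E int_w int_l in auto)
  also have "\<dots> = 2 / (\<mu> * R) * (LINT X|lborel. w X) - \<mu> * (LINT X|lborel. l X)"
    using int_w int_l by simp
  finally have E: "(LINT X|lborel. E1 X) - (LINT X|lborel. E0 X)
      \<le> 2 / (\<mu> * R) * (LINT X|lborel. w X) - \<mu> * (LINT X|lborel. l X)" .
  have "(LINT X|lborel. \<sigma> X) \<le> (LINT X|lborel. w X)"
  proof (rule integral_mono[OF int_\<sigma> int_w])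
    show "\<sigma> X \<le> w X" for X
      using side_shift[of X 0] by (auto simp: \<sigma>_def w_def indicator_def zero_prod_def[symmetric])
  qed
  moreover have "(LINT X|lborel. \<tau> X) \<le> (LINT X|lborel. w X)"
    using integral_q_power2_side_le by (simp add: \<tau>_def w_def)
  ultimately have S: "1 / (2 * \<mu> * R) * ((LINT X|lborel. \<sigma> X) + 12 * (LINT X|lborel. \<tau> X))
      \<le> 1 / (2 * \<mu> * R) * (13 * (LINT X|lborel. w X))"
    using \<mu>_pos R_pos by (intro mult_left_mono) auto
  have B: "\<mu> / 4 * (LINT x|lborel. b x) \<le> \<mu> / 4 * (LINT X|lborel. l X)"
    using integral_q_power2_bottom_le \<mu>_pos by (intro mult_left_mono) (auto simp: b_def l_def)
  \<comment> \<open>Stated for arbitrary reals, so that linear arithmetic treats the integrals with their factors as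
    atoms.\<close>
  have absorb: "m / 4 \<le> c + 1 / 2 * p + s'"
    if "0 \<le> 1 / 2 * e + s + (b' + c)" "e \<le> p - m" "s \<le> s'" "b' \<le> m / 4" for e s b' c p m s' :: real
    using that by linarith
  have "\<mu> / 4 * (LINT X|lborel. l X) \<le> 1 / \<mu> * (LINT x|lborel. \<gamma> x)
      + 1 / 2 * (2 / (\<mu> * R) * (LINT X|lborel. w X)) + 1 / (2 * \<mu> * R) * (13 * (LINT X|lborel. w X))"
    using absorb[OF total E S] B by simp
  also have "\<dots> = 1 / \<mu> * (LINT x|lborel. \<gamma> x) + 15 / (2 * \<mu> * R) * (LINT X|lborel. w X)"
    using \<mu>_pos R_pos by (simp add: field_simps)
  finally have "4 / \<mu> * (\<mu> / 4 * (LINT X|lborel. l X))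
      \<le> 4 / \<mu> * (1 / \<mu> * (LINT x|lborel. \<gamma> x) + 15 / (2 * \<mu> * R) * (LINT X|lborel. w X))"
    using \<mu>_pos by (intro mult_left_mono) auto
  also have "4 / \<mu> * (\<mu> / 4 * (LINT X|lborel. l X)) = (LINT X|lborel. l X)"
    using \<mu>_pos by simp
  also have "4 / \<mu> * (1 / \<mu> * (LINT x|lborel. \<gamma> x) + 15 / (2 * \<mu> * R) * (LINT X|lborel. w X))
      = 4 / \<mu>\<^sup>2 * (LINT x|lborel. \<gamma> x) + 30 / \<mu>\<^sup>2 / R * (LINT X|lborel. w X)"
    using \<mu>_pos R_pos by (simp add: field_simps power2_eq_square)
  finally show ?thesis
    by (simp add: l_def w_def \<gamma>_def)
qed

text \<open>
  The weight \<open>\<alpha>\<close> is one on the ball of radius \<open>R\<close>, and passing from \<open>[0, 1]\<close> to \<open>(0, 1]\<close> removes a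
  null set of heights.
\<close>
lemma slab_integral_le:
  "(LINT t:{0..1}|lborel. (LINT x:ball x\<^sub>0 R|lborel. (norm (Du (x, t)))\<^sup>2))
    \<le> (LINT X|lborel. indicator {0<..1} (snd X) * \<alpha> (fst X) * (norm (D X))\<^sup>2)"
proof -
  define f where "f X = indicator (ball x\<^sub>0 R) (fst X) * (norm (D X))\<^sup>2" for X
  have [measurable]: "(\<lambda>X::(real ^ 'd) \<times> real. indicator (ball x\<^sub>0 R) (fst X) :: real) \<in> borel_measurable borel"
    by (rule measurable_compose[OF fst_snd_borel(1) borel_measurable_indicator]) simp
  have f_int: "integrable lborel f"
    unfolding f_def[abs_def]
    by (rule integrable_mult_abs_le_1[OF integrable_norm_D_power2]) (auto simp: indicator_def)
  have slab_int: "integrable lborel (\<lambda>X. indicator {0<..1} (snd X) * f X)"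
    by (rule integrable_mult_abs_le_1[OF f_int]) (auto simp: indicator_def)
  define h where "h t = (LINT x|lborel. f (x, t))" for t
  have [measurable]: "h \<in> borel_measurable borel"
    using lborel_pair.integrable_snd[of "\<lambda>x t. f (x, t)"] f_int
    unfolding h_def[abs_def] by (simp add: lborel_prod borel_measurable_integrable)
  have "(LINT t:{0..1}|lborel. (LINT x:ball x\<^sub>0 R|lborel. (norm (Du (x, t)))\<^sup>2))
      = (LINT t|lborel. indicator {0..1} t * h t)"
    unfolding set_lebesgue_integral_def h_def
  proof (rule Bochner_Integration.integral_cong[OF refl])
    fix t :: real
    have "indicator (ball x\<^sub>0 R) x *\<^sub>R (norm (Du (x, t)))\<^sup>2 = f (x, t)" if "t \<in> {0..1}" for x
      using that R_gt_1 by (auto simp: f_def D_def K_def indicator_def)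
    then show "indicator {0..1} t *\<^sub>R (LINT x|lborel. indicator (ball x\<^sub>0 R) x *\<^sub>R (norm (Du (x, t)))\<^sup>2)
        = indicator {0..1} t * (LINT x|lborel. f (x, t))"
      by (cases "t \<in> {0..1}") auto
  qed
  also have "\<dots> = (LINT t|lborel. indicator {0<..1} t * h t)"
    by (rule integral_greaterThanAtMost_eq_atLeastAtMost[symmetric]) measurable
  also have "\<dots> = (LINT X|lborel. indicator {0<..1} (snd X) * f X)"
    using lborel_integral_snd[OF slab_int] by (simp add: h_def)
  also have "\<dots> \<le> (LINT X|lborel. indicator {0<..1} (snd X) * \<alpha> (fst X) * (norm (D X))\<^sup>2)"
  proof (rule integral_mono[OF slab_int])
    show "integrable lborel (\<lambda>X. indicator {0<..1} (snd X) * \<alpha> (fst X) * (norm (D X))\<^sup>2)"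
      by (rule integrable_mult_abs_le_1[OF integrable_norm_D_power2])
         (use \<alpha>_bounds in \<open>auto simp: indicator_def\<close>)
    show "indicator {0<..1} (snd X) * f X
        \<le> indicator {0<..1} (snd X) * \<alpha> (fst X) * (norm (D X))\<^sup>2" for X
      using \<alpha>_eq_1[of "fst X"] \<alpha>_bounds(1)[of "fst X"]
      by (auto simp: f_def indicator_def dist_commute)
  qed
  finally show ?thesis .
qed

lemma slab_estimate:
  "(LINT t:{0..1}|lborel. (LINT x:ball x\<^sub>0 R|lborel. (norm (Du (x, t)))\<^sup>2))
    \<le> 30 / \<mu>\<^sup>2 * (LINT x:ball x\<^sub>0 (2 * R)|lborel. (g x)\<^sup>2)
      + 30 / \<mu>\<^sup>2 / R * (LINT X:T_cyl x\<^sub>0 (3 * R) - T_cyl x\<^sub>0 R|lborel. (norm (Du X))\<^sup>2)"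
proof -
  have shell: "(LINT X:T_cyl x\<^sub>0 (3 * R) - T_cyl x\<^sub>0 R|lborel. (norm (Du X))\<^sup>2)
      = (LINT X|lborel. indicator shell X * (norm (D X))\<^sup>2)"
    unfolding set_lebesgue_integral_def shell_def[symmetric]
    by (rule Bochner_Integration.integral_cong[OF refl])
       (auto simp: D_def K_def shell_def T_cyl_def indicator_def)
  have "4 / \<mu>\<^sup>2 * (LINT x:ball x\<^sub>0 (2 * R)|lborel. (g x)\<^sup>2)
      \<le> 30 / \<mu>\<^sup>2 * (LINT x:ball x\<^sub>0 (2 * R)|lborel. (g x)\<^sup>2)"
    unfolding set_lebesgue_integral_def
    by (intro mult_right_mono divide_right_mono Bochner_Integration.integral_nonneg) auto
  then show ?thesis
    using slab_integral_le weighted_slab_estimate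
    unfolding shell by (simp add: set_lebesgue_integral_def)
qed

end

theorem lemma3p2:
  fixes \<mu> :: real
  assumes "CARD('d::finite) \<ge> 2" and "\<mu> > 0"
  shows "\<exists>C>0. \<forall>(a :: (real ^ 'd) \<times> real \<Rightarrow> (real ^ 'd) \<times> real \<Rightarrow> (real ^ 'd) \<times> real \<Rightarrow> real)
            (x\<^sub>0 :: real ^ 'd) (R :: real)
            (u :: (real ^ 'd) \<times> real \<Rightarrow> real)
            (Du :: (real ^ 'd) \<times> real \<Rightarrow> (real ^ 'd) \<times> real)
            (g :: real ^ 'd \<Rightarrow> real).
          (\<forall>i\<in>Basis. \<forall>j\<in>Basis. smooth (a i j)) \<longrightarrow>
          symmetric_coeffs a \<longrightarrow>
          elliptic_coeffs \<mu> a \<longrightarrow>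
          (\<forall>i\<in>Basis. \<forall>j\<in>Basis. \<forall>x t. a i j (x, t + 1) = a i j (x, t)) \<longrightarrow>
          R > 10 \<longrightarrow>
          C1_closure_with_grad (T_cyl x\<^sub>0 (3 * R)) u Du \<longrightarrow>
          weak_solution a (T_cyl x\<^sub>0 (3 * R)) Du \<longrightarrow>
          (\<forall>x\<in>ball x\<^sub>0 (3 * R). conormal_deriv a Du (0, -1) (x, 0) = g x) \<longrightarrow>
          (LINT t:{0..1}|lborel. (LINT x:ball x\<^sub>0 R|lborel. (norm (Du (x, t)))\<^sup>2))
            \<le> C * (LINT x:ball x\<^sub>0 (2 * R)|lborel. (g x)\<^sup>2)
              + C / R * (LINT X:T_cyl x\<^sub>0 (3 * R) - T_cyl x\<^sub>0 R|lborel. (norm (Du X))\<^sup>2)"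
proof (intro exI[of _ "30 / \<mu>\<^sup>2"] conjI allI impI)
  show "30 / \<mu>\<^sup>2 > 0" using \<open>\<mu> > 0\<close> by simp
  fix a :: "(real ^ 'd) \<times> real \<Rightarrow> (real ^ 'd) \<times> real \<Rightarrow> (real ^ 'd) \<times> real \<Rightarrow> real"
    and x\<^sub>0 :: "real ^ 'd" and R :: real and u :: "(real ^ 'd) \<times> real \<Rightarrow> real"
    and Du :: "(real ^ 'd) \<times> real \<Rightarrow> (real ^ 'd) \<times> real" and g :: "real ^ 'd \<Rightarrow> real"
  assume smooth: "\<forall>i\<in>Basis. \<forall>j\<in>Basis. smooth (a i j)"
    and hyps: "symmetric_coeffs a" "elliptic_coeffs \<mu> a"
      "\<forall>i\<in>Basis. \<forall>j\<in>Basis. \<forall>x t. a i j (x, t + 1) = a i j (x, t)" "R > 10"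
      "C1_closure_with_grad (T_cyl x\<^sub>0 (3 * R)) u Du" "weak_solution a (T_cyl x\<^sub>0 (3 * R)) Du"
      "\<forall>x\<in>ball x\<^sub>0 (3 * R). conormal_deriv a Du (0, -1) (x, 0) = g x"
  have "continuous_on UNIV (a i j)" if "i \<in> Basis" "j \<in> Basis" for i j
    using smooth that unfolding smooth_def by (metis Ck.simps(1))
  then interpret neumann_cylinder a \<mu> R x\<^sub>0 u Du g
    by unfold_locales (use hyps \<open>\<mu> > 0\<close> in auto)
  show "(LINT t:{0..1}|lborel. (LINT x:ball x\<^sub>0 R|lborel. (norm (Du (x, t)))\<^sup>2))
      \<le> 30 / \<mu>\<^sup>2 * (LINT x:ball x\<^sub>0 (2 * R)|lborel. (g x)\<^sup>2)
        + 30 / \<mu>\<^sup>2 / R * (LINT X:T_cyl x\<^sub>0 (3 * R) - T_cyl x\<^sub>0 R|lborel. (norm (Du X))\<^sup>2)"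
    by (rule slab_estimate)
qed

end
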